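(* Every finitely generated group $G$ admits a finite symmetric generating set $S\subseteq G\setminus\{1\}$ such that the automorphism group of the Cayley graph $\mathrm{Cay}(G,S)$ is countable.
   Context: Given a group $G$ and a symmetric generating set $S\subseteq G\setminus\{1\}$ (that is, $S=S^{-1}$), the Cayley graph $\mathrm{Cay}(G,S)$ is the simple unoriented graph with vertex set $G$ and an edge between $g$ and $h$ precisely when $g^{-1}h\in S$. Countable means finite or countably infinite. *)

theory Defs
  imports "HOL-Algebra.Algebra" "HOL-Library.Countable_Set"
begin

definition finitely_generated :: "('a, 'b) monoid_scheme \<Rightarrow> bool" where
  "finitely_generated G \<longleftrightarrow>
     (\<exists>A. finite A \<and> A \<subseteq> carrier G \<and> generate G A = carrier G)"

definition symmetric_generating_set :: "('a, 'b) monoid_scheme \<Rightarrow> 'a set \<Rightarrow> bool" where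
  "symmetric_generating_set G S \<longleftrightarrow>
     S \<subseteq> carrier G \<and> m_inv G ` S = S \<and> generate G S = carrier G"

record 'a simple_graph =
  vertices :: "'a set"
  edges :: "'a set set"

definition cayley_graph :: "('a, 'b) monoid_scheme \<Rightarrow> 'a set \<Rightarrow> 'a simple_graph" where
  "cayley_graph G S =
     \<lparr>vertices = carrier G,
      edges = {{g, h} | g h. g \<in> carrier G \<and> h \<in> carrier G \<and> inv\<^bsub>G\<^esub> g \<otimes>\<^bsub>G\<^esub> h \<in> S}\<rparr>"

(* As for Bij, automorphisms are extensional functions on the vertex set, so that
   distinct elements of type 'a => 'a are distinct as maps on the vertices. *)
definition graph_auto :: "'a simple_graph \<Rightarrow> ('a \<Rightarrow> 'a) set" where
  "graph_auto \<Gamma> =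
     {f \<in> Bij (vertices \<Gamma>). \<forall>x \<in> vertices \<Gamma>. \<forall>y \<in> vertices \<Gamma>.
        {f x, f y} \<in> edges \<Gamma> \<longleftrightarrow> {x, y} \<in> edges \<Gamma>}"

definition GraphAutoGroup :: "'a simple_graph \<Rightarrow> ('a \<Rightarrow> 'a) monoid" where
  "GraphAutoGroup \<Gamma> = BijGroup (vertices \<Gamma>) \<lparr>carrier := graph_auto \<Gamma>\<rparr>"

lemma subgroup_graph_auto: "subgroup (graph_auto \<Gamma>) (BijGroup (vertices \<Gamma>))"
proof -
  let ?V = "vertices \<Gamma>"
  interpret B: group "BijGroup ?V" by (rule group_BijGroup)
  show ?thesis
  proof (rule B.subgroupI)
    show "graph_auto \<Gamma> \<subseteq> carrier (BijGroup ?V)"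
      by (auto simp: graph_auto_def BijGroup_def)
    have "(\<lambda>x\<in>?V. x) \<in> graph_auto \<Gamma>"
      by (simp add: graph_auto_def id_Bij)
    then show "graph_auto \<Gamma> \<noteq> {}" by blast
  next
    fix f assume f: "f \<in> graph_auto \<Gamma>"
    then have fB: "f \<in> Bij ?V" by (simp add: graph_auto_def)
    have inv: "inv\<^bsub>BijGroup ?V\<^esub> f = (\<lambda>x\<in>?V. inv_into ?V f x)"
      using fB by (rule inv_BijGroup)
    have surj: "f ` ?V = ?V" using fB by (auto simp: Bij_def bij_betw_def)
    show "inv\<^bsub>BijGroup ?V\<^esub> f \<in> graph_auto \<Gamma>"
      unfolding inv graph_auto_def
    proof (intro CollectI conjI ballI)
      show "(\<lambda>x\<in>?V. inv_into ?V f x) \<in> Bij ?V" using fB by (rule restrict_inv_into_Bij)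
    next
      fix x y assume xy: "x \<in> ?V" "y \<in> ?V"
      let ?x = "inv_into ?V f x" and ?y = "inv_into ?V f y"
      have "?x \<in> ?V" "?y \<in> ?V" "f ?x = x" "f ?y = y"
        using xy surj by (auto intro: inv_into_into f_inv_into_f)
      then have "{x, y} \<in> edges \<Gamma> \<longleftrightarrow> {?x, ?y} \<in> edges \<Gamma>"
        using f unfolding graph_auto_def by fastforce
      then show "{(\<lambda>x\<in>?V. inv_into ?V f x) x, (\<lambda>x\<in>?V. inv_into ?V f x) y} \<in> edges \<Gamma>
          \<longleftrightarrow> {x, y} \<in> edges \<Gamma>"
        using xy by simp
    qed
  next
    fix f g assume fg: "f \<in> graph_auto \<Gamma>" "g \<in> graph_auto \<Gamma>"
    then have B: "f \<in> Bij ?V" "g \<in> Bij ?V" by (auto simp: graph_auto_def)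
    then have "g \<in> ?V \<rightarrow> ?V" by (simp add: Bij_imp_funcset)
    then show "f \<otimes>\<^bsub>BijGroup ?V\<^esub> g \<in> graph_auto \<Gamma>"
      using fg B compose_Bij[OF B]
      by (auto simp: graph_auto_def BijGroup_def compose_eq Pi_iff)
  qed
qed

lemma group_GraphAutoGroup: "group (GraphAutoGroup \<Gamma>)"
  unfolding GraphAutoGroup_def
  by (rule group.subgroup_imp_group[OF group_BijGroup subgroup_graph_auto])

context group
begin

lemma cayley_graph_edge_iff:
  assumes S: "S \<subseteq> carrier G" "m_inv G ` S = S" and gh: "g \<in> carrier G" "h \<in> carrier G"
  shows "{g, h} \<in> edges (cayley_graph G S) \<longleftrightarrow> inv g \<otimes> h \<in> S"
proof -
  have "inv h \<otimes> g \<in> S \<Longrightarrow> inv g \<otimes> h \<in> S"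
    using S gh by (metis imageI inv_closed inv_inv inv_mult_group)
  then show ?thesis
    using gh by (auto simp: cayley_graph_def doubleton_eq_iff)
qed

lemma cayley_graph_edge_card:
  assumes "\<one> \<notin> S" "e \<in> edges (cayley_graph G S)"
  shows "e \<subseteq> vertices (cayley_graph G S) \<and> card e = 2"
  using assms by (fastforce simp: cayley_graph_def card_2_iff l_inv)

end

end

(* The gadget {x, x^-1, x^-1 s, s^-1 x} added to a connection set puts new triangles on the
   edges labelled s. If x is generic it does so on hardly any other old label, and its own edges lie in
   at most 8 triangles. Repeating this, the labels from a prescribed finite symmetric set are told apart,
   up to inversion, by the number of triangles on an edge, so every automorphism f satisfies
   f (g s) = f g s or f g s^-1 for all of them. If these labels include the short words in the
   generators, an automorphism fixing a small ball pointwise is the identity, hence automorphisms are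
   determined by their values on a finite set.

   Genericity of x means avoiding equations x a x^-1 = b and x a x = b. The first ones define cosets of
   centralizers, so by B. H. Neumann's theorem on coset covers only those of finite index matter, and
   one can work inside these. If the FC-center has infinite index, finitely many equations of the
   second kind do not cover the group either; otherwise there is an abelian subgroup of finite index,
   on which their solution sets are again cosets. *)
theory Submission
  imports Defs
begin

context group
begin

subsection \<open>Subgroups of finite index and negligible sets\<close>

text \<open>Inversion is an automorphism of every Cayley graph of an abelian group, so labels can at
  best be recognised up to inversion, and the remaining ambiguity has to be removed by comparing one
  vertex with many fixed vertices at once. This is why the labels
  \<open>inv u \<otimes> p \<otimes> t\<close> are used.

  Quadratic equations cannot all be avoided either. In the infinite dihedral group a translation
  \<open>x\<close> satisfies \<open>x \<otimes> a \<otimes> x = a\<close> for every reflection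
  \<open>a\<close>, while a reflection \<open>x\<close> satisfies
  \<open>x \<otimes> \<one> \<otimes> x = \<one>\<close>. The set \<open>V\<close> records the
  labels at which the first kind of coincidence is accepted. Its price is that the gadget for
  \<open>s\<close> may put triangles on the squares of \<open>s\<close> and \<open>inv s\<close>
  too.

  The number 8 is 2 * 4: a gadget has at most four elements, and a triangle on a new edge has a
  second new side, in one of two positions. Labels that are to be recognised get more than 8
  triangles and so cannot be confused with auxiliary ones.\<close>

lemma inv_cancel_left: "x \<in> carrier G \<Longrightarrow> y \<in> carrier G \<Longrightarrow> inv x \<otimes> (x \<otimes> y) = y"
  by (simp add: m_assoc[symmetric])

lemma cancel_inv_left: "x \<in> carrier G \<Longrightarrow> y \<in> carrier G \<Longrightarrow> x \<otimes> (inv x \<otimes> y) = y"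
  by (simp add: m_assoc[symmetric])

lemmas group_simps = m_assoc inv_mult_group inv_cancel_left cancel_inv_left

text \<open>\<open>g \<otimes> inv r \<in> H\<close> says that \<open>g\<close> lies in the right
  coset \<open>H #> r\<close>. Stating this for arbitrary sets makes the notion monotone.\<close>

definition finite_index :: "'a set \<Rightarrow> bool" where
  "finite_index H \<longleftrightarrow>
     (\<exists>R. finite R \<and> R \<subseteq> carrier G \<and> (\<forall>g\<in>carrier G. \<exists>r\<in>R. g \<otimes> inv r \<in> H))"

lemma finite_index_mono: "finite_index H \<Longrightarrow> H \<subseteq> K \<Longrightarrow> finite_index K"
  unfolding finite_index_def by (meson subsetD)

lemma finite_index_carrier: "finite_index (carrier G)"
  unfolding finite_index_def by (intro exI[of _ "{\<one>}"]) auto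

lemma subgroup_mult_inv:
  assumes "subgroup H G" "g \<in> carrier G" "c \<in> carrier G" "r \<in> carrier G"
    and "g \<otimes> inv r \<in> H" "c \<otimes> inv r \<in> H"
  shows "g \<otimes> inv c \<in> H"
proof -
  have "(g \<otimes> inv r) \<otimes> inv (c \<otimes> inv r) \<in> H"
    using assms by (meson subgroup.m_closed subgroup.m_inv_closed)
  then show ?thesis using assms(2-4) by (simp add: group_simps)
qed

text \<open>A coset of \<open>H\<close> and a coset of \<open>K\<close> meet in the empty set or in
  one coset of \<open>H \<inter> K\<close>.\<close>

lemma finite_index_Int:
  assumes HK: "subgroup H G" "subgroup K G" and fi: "finite_index H" "finite_index K"
  shows "finite_index (H \<inter> K)"
proof -
  obtain R where R: "finite R" "R \<subseteq> carrier G" "\<And>g. g \<in> carrier G \<Longrightarrow> \<exists>r\<in>R. g \<otimes> inv r \<in> H"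
    using fi(1) unfolding finite_index_def by blast
  obtain Q where Q: "finite Q" "Q \<subseteq> carrier G" "\<And>g. g \<in> carrier G \<Longrightarrow> \<exists>r\<in>Q. g \<otimes> inv r \<in> K"
    using fi(2) unfolding finite_index_def by blast
  define P where "P p g \<longleftrightarrow> g \<in> carrier G \<and> g \<otimes> inv (fst p) \<in> H \<and> g \<otimes> inv (snd p) \<in> K" for p g
  \<comment> \<open>\<open>c\<close> picks a point in each nonempty intersection;
    \<open>\<one>\<close> is a default value that keeps \<open>c\<close> inside the group.\<close>
  define c where "c p = (if \<exists>g. P p g then (SOME g. P p g) else \<one>)" for p
  have c: "P p (c p)" if "P p g" for p g
    using that unfolding c_def by (auto intro: someI)
  have cG: "c p \<in> carrier G" for p
  proof (cases "\<exists>g. P p g")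
    case True
    then show ?thesis using c unfolding P_def by blast
  next
    case False
    then show ?thesis unfolding c_def by auto
  qed
  show ?thesis
    unfolding finite_index_def
  proof (intro exI[of _ "c ` (R \<times> Q)"] conjI ballI)
    fix g assume g: "g \<in> carrier G"
    obtain r q where rq: "r \<in> R" "q \<in> Q" "g \<otimes> inv r \<in> H" "g \<otimes> inv q \<in> K"
      using R(3)[OF g] Q(3)[OF g] by blast
    then have "P (r, q) (c (r, q))" using c[of "(r, q)" g] g unfolding P_def by simp
    then have "g \<otimes> inv (c (r, q)) \<in> H \<inter> K"
      using subgroup_mult_inv[OF HK(1) g cG] subgroup_mult_inv[OF HK(2) g cG] rq R(2) Q(2)
      unfolding P_def by (metis Int_iff fst_conv snd_conv subsetD)
    then show "\<exists>r\<in>c ` (R \<times> Q). g \<otimes> inv r \<in> H \<inter> K" using rq by blast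
  qed (use R Q cG in auto)
qed

lemma finite_index_INT:
  assumes "finite I" "\<And>i. i \<in> I \<Longrightarrow> subgroup (H i) G" "\<And>i. i \<in> I \<Longrightarrow> finite_index (H i)"
  shows "finite_index (carrier G \<inter> (\<Inter>i\<in>I. H i)) \<and> subgroup (carrier G \<inter> (\<Inter>i\<in>I. H i)) G"
  using assms
proof (induction I rule: finite_induct)
  case empty
  then show ?case using finite_index_carrier subgroup_self by simp
next
  case (insert i I)
  let ?K = "carrier G \<inter> (\<Inter>i\<in>I. H i)"
  have eq: "carrier G \<inter> (\<Inter>i\<in>insert i I. H i) = H i \<inter> ?K" by auto
  show ?case
    unfolding eq using insert finite_index_Int subgroups_Inter_pair by simp
qed

text \<open>Greedy choice: finitely many cosets of \<open>H\<close> never exhaust the group. The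
  prescribed size serves a pigeonhole argument over finitely many equations.\<close>

lemma infinite_index_separated:
  assumes H: "subgroup H G" "\<not> finite_index H"
  shows "\<exists>R. finite R \<and> card R = n \<and> R \<subseteq> carrier G \<and> (\<forall>r\<in>R. \<forall>q\<in>R. r \<noteq> q \<longrightarrow> r \<otimes> inv q \<notin> H)"
proof (induction n)
  case 0
  then show ?case by (intro exI[of _ "{}"]) simp
next
  case (Suc n)
  then obtain R where R: "finite R" "card R = n" "R \<subseteq> carrier G"
    "\<forall>r\<in>R. \<forall>q\<in>R. r \<noteq> q \<longrightarrow> r \<otimes> inv q \<notin> H" by blast
  have "\<not> (\<forall>g\<in>carrier G. \<exists>r\<in>R. g \<otimes> inv r \<in> H)"
    using H(2) R(1,3) unfolding finite_index_def by metis
  then obtain g where g: "g \<in> carrier G" "\<forall>r\<in>R. g \<otimes> inv r \<notin> H" by blast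
  have g': "r \<otimes> inv g \<notin> H" if "r \<in> R" for r
  proof
    assume "r \<otimes> inv g \<in> H"
    then have "inv (r \<otimes> inv g) \<in> H" by (rule subgroup.m_inv_closed[OF H(1)])
    moreover have "inv (r \<otimes> inv g) = g \<otimes> inv r" using g(1) that R(3) by (simp add: inv_mult_group subsetD)
    ultimately show False using g(2) that by simp
  qed
  have "g \<otimes> inv g \<in> H" using g(1) subgroup.one_closed[OF H(1)] by simp
  then have "g \<notin> R" using g(2) by blast
  then have "card (insert g R) = Suc n" using R by simp
  moreover have "\<forall>r\<in>insert g R. \<forall>q\<in>insert g R. r \<noteq> q \<longrightarrow> r \<otimes> inv q \<notin> H"
    using R(4) g(2) g' by blast
  ultimately show ?case using R(1,3) g(1) by (intro exI[of _ "insert g R"]) blast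
qed

section \<open>Negligible sets and coset covers\<close>

text \<open>The ideal of sets that generic elements avoid. B. H. Neumann's theorem on coset covers
  says that it is proper.\<close>

definition negligible :: "'a set \<Rightarrow> bool" where
  "negligible A \<longleftrightarrow>
     (\<exists>P. finite P \<and> (\<forall>(H, g)\<in>P. subgroup H G \<and> \<not> finite_index H \<and> g \<in> carrier G) \<and>
          A \<subseteq> (\<Union>(H, g)\<in>P. H #> g))"

lemma negligible_mono: "negligible Y \<Longrightarrow> A \<subseteq> Y \<Longrightarrow> negligible A"
  unfolding negligible_def by (meson order_trans)

lemma negligible_coset:
  "subgroup H G \<Longrightarrow> \<not> finite_index H \<Longrightarrow> g \<in> carrier G \<Longrightarrow> negligible (H #> g)"
  unfolding negligible_def by (intro exI[of _ "{(H, g)}"]) auto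

lemma negligible_empty: "negligible {}"
  unfolding negligible_def by (intro exI[of _ "{}"]) auto

lemma negligible_Un: assumes "negligible A" "negligible B" shows "negligible (A \<union> B)"
proof -
  obtain P where P: "finite P" "\<forall>(H, g)\<in>P. subgroup H G \<and> \<not> finite_index H \<and> g \<in> carrier G"
    "A \<subseteq> (\<Union>(H, g)\<in>P. H #> g)" using assms(1) unfolding negligible_def by blast
  obtain Q where Q: "finite Q" "\<forall>(H, g)\<in>Q. subgroup H G \<and> \<not> finite_index H \<and> g \<in> carrier G"
    "B \<subseteq> (\<Union>(H, g)\<in>Q. H #> g)" using assms(2) unfolding negligible_def by blast
  show ?thesis
    unfolding negligible_def
  proof (intro exI[of _ "P \<union> Q"] conjI)
    show "A \<union> B \<subseteq> (\<Union>(H, g)\<in>P \<union> Q. H #> g)"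
      using P(3) Q(3) by (simp add: UN_Un le_supI1 le_supI2)
  qed (use P(1,2) Q(1,2) in \<open>simp_all add: ball_Un\<close>)
qed

lemma negligible_UN:
  "finite I \<Longrightarrow> (\<And>i. i \<in> I \<Longrightarrow> negligible (A i)) \<Longrightarrow> negligible (\<Union>i\<in>I. A i)"
  by (induction I rule: finite_induct) (auto simp: negligible_empty negligible_Un)

lemma negligible_translate:
  assumes "negligible A" "h \<in> carrier G"
  shows "negligible {y \<in> carrier G. y \<otimes> h \<in> A}"
proof -
  obtain P where P: "finite P" "\<forall>(H, g)\<in>P. subgroup H G \<and> \<not> finite_index H \<and> g \<in> carrier G"
    "A \<subseteq> (\<Union>(H, g)\<in>P. H #> g)" using assms(1) unfolding negligible_def by blast
  have "{y \<in> carrier G. y \<otimes> h \<in> A} \<subseteq> (\<Union>p\<in>P. fst p #> (snd p \<otimes> inv h))"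
  proof
    fix y assume y: "y \<in> {y \<in> carrier G. y \<otimes> h \<in> A}"
    then obtain K g where Kg: "(K, g) \<in> P" "y \<otimes> h \<in> K #> g" using P(3) by blast
    then obtain k where k: "k \<in> K" "y \<otimes> h = k \<otimes> g" by (auto simp: r_coset_def)
    have kg: "k \<in> carrier G" "g \<in> carrier G"
      using P(2) Kg k by (auto dest: subgroup.mem_carrier)
    have "(y \<otimes> h) \<otimes> inv h = (k \<otimes> g) \<otimes> inv h" using k by simp
    then have "y = k \<otimes> (g \<otimes> inv h)" using y kg assms(2) by (simp add: group_simps)
    then show "y \<in> (\<Union>p\<in>P. fst p #> (snd p \<otimes> inv h))"
      using Kg k by (force simp: r_coset_def)
  qed
  moreover have "negligible (\<Union>p\<in>P. fst p #> (snd p \<otimes> inv h))"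
    using P assms(2) by (intro negligible_UN) (auto intro!: negligible_coset)
  ultimately show ?thesis using negligible_mono by blast
qed

text \<open>B. H. Neumann: if some coset of \<open>H\<close> is missing from the list, it is covered by cosets of the
  other subgroups; hence so is every coset of \<open>H\<close>, and \<open>H\<close> can be dropped.\<close>
lemma coset_cover_finite_index:
  assumes "finite \<H>" "\<And>H. H \<in> \<H> \<Longrightarrow> subgroup H G"
    and "finite P" "P \<subseteq> \<H> \<times> carrier G" "carrier G \<subseteq> (\<Union>(H, g)\<in>P. H #> g)"
  shows "\<exists>H\<in>\<H>. finite_index H"
  using assms
proof (induction \<H> arbitrary: P rule: finite_induct)
  case empty
  then show ?case by auto
next
  case (insert H \<H>)
  show ?case
  proof (cases "finite_index H")
    case True
    then show ?thesis by simp
  next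
    case False
    have H: "subgroup H G" using insert.prems(1) by simp
    define R where "R = {g. (H, g) \<in> P}"
    define Q where "Q = {p \<in> P. fst p \<noteq> H}"
    have R: "finite R" "R \<subseteq> carrier G"
    proof -
      have "R = snd ` {p \<in> P. fst p = H}" unfolding R_def by force
      then show "finite R" using insert.prems(2) by simp
      show "R \<subseteq> carrier G" unfolding R_def using insert.prems(3) by auto
    qed
    have Q: "finite Q" "Q \<subseteq> \<H> \<times> carrier G"
      using insert.prems unfolding Q_def by auto
    have "\<not> (\<forall>g\<in>carrier G. \<exists>r\<in>R. g \<otimes> inv r \<in> H)"
      using False R unfolding finite_index_def by metis
    then obtain g where g: "g \<in> carrier G" "\<And>r. r \<in> R \<Longrightarrow> g \<otimes> inv r \<notin> H" by blast
    have hg: "\<exists>(K, c)\<in>Q. h \<otimes> g \<in> K #> c" if h: "h \<in> H" for h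
    proof -
      have hG: "h \<in> carrier G" using H h by (rule subgroup.mem_carrier)
      then obtain K c where Kc: "(K, c) \<in> P" "h \<otimes> g \<in> K #> c"
        using insert.prems(4) g(1) by blast
      have "K \<noteq> H"
      proof
        assume "K = H"
        then have c: "c \<in> R" using Kc unfolding R_def by simp
        then have cG: "c \<in> carrier G" using R by blast
        obtain k where k: "k \<in> H" "h \<otimes> g = k \<otimes> c" using Kc \<open>K = H\<close> by (auto simp: r_coset_def)
        then have kG: "k \<in> carrier G" using H by (auto dest: subgroup.mem_carrier)
        have "inv h \<otimes> (h \<otimes> g) \<otimes> inv c = inv h \<otimes> (k \<otimes> c) \<otimes> inv c" using k by simp
        then have "g \<otimes> inv c = inv h \<otimes> k" using hG g(1) kG cG by (simp add: group_simps)
        then have "g \<otimes> inv c \<in> H" using H h k by (simp add: subgroup.m_closed subgroup.m_inv_closed)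
        then show False using g(2) c by blast
      qed
      then show ?thesis using Kc unfolding Q_def by force
    qed
    \<comment> \<open>Right multiplication by \<open>inv g \<otimes> r\<close> carries
      \<open>H #> g\<close> to \<open>H #> r\<close>, so the cover of \<open>H #> g\<close> by
      cosets in \<open>Q\<close> becomes a cover of each listed coset of \<open>H\<close>.\<close>
    define Q' where "Q' = Q \<union> (\<lambda>((K, c), r). (K, c \<otimes> inv g \<otimes> r)) ` (Q \<times> R)"
    have "\<exists>H\<in>\<H>. finite_index H"
    proof (rule insert.IH)
      show "\<And>H. H \<in> \<H> \<Longrightarrow> subgroup H G" using insert.prems(1) by simp
      show "finite Q'" unfolding Q'_def using Q R by simp
      show "Q' \<subseteq> \<H> \<times> carrier G" unfolding Q'_def using Q R g(1) by fastforce
      show "carrier G \<subseteq> (\<Union>(H, g)\<in>Q'. H #> g)"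
      proof
        fix y assume y: "y \<in> carrier G"
        then obtain K c where Kc: "(K, c) \<in> P" "y \<in> K #> c" using insert.prems(4) by blast
        show "y \<in> (\<Union>(H, g)\<in>Q'. H #> g)"
        proof (cases "K = H")
          case False
          then have "(K, c) \<in> Q'" using Kc unfolding Q'_def Q_def by simp
          then show ?thesis using Kc by blast
        next
          case True
          then have c: "c \<in> R" "c \<in> carrier G" using Kc R unfolding R_def by auto
          obtain h where h: "h \<in> H" "y = h \<otimes> c" using Kc True by (auto simp: r_coset_def)
          have hG: "h \<in> carrier G" using H h by (auto dest: subgroup.mem_carrier)
          obtain L d where Ld: "(L, d) \<in> Q" "h \<otimes> g \<in> L #> d" using hg[OF h(1)] by blast
          then obtain l where l: "l \<in> L" "h \<otimes> g = l \<otimes> d" by (auto simp: r_coset_def)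
          have "subgroup L G" "d \<in> carrier G" using Ld Q insert.prems(1) by auto
          then have lG: "l \<in> carrier G" "d \<in> carrier G" using l by (auto dest: subgroup.mem_carrier)
          have "(h \<otimes> g) \<otimes> inv g \<otimes> c = (l \<otimes> d) \<otimes> inv g \<otimes> c" using l by simp
          then have "y = l \<otimes> (d \<otimes> inv g \<otimes> c)" using h hG lG g(1) c by (simp add: group_simps)
          then have "y \<in> L #> (d \<otimes> inv g \<otimes> c)" using l by (auto simp: r_coset_def)
          moreover have "(L, d \<otimes> inv g \<otimes> c) \<in> Q'"
            unfolding Q'_def using Ld c by force
          ultimately show ?thesis by blast
        qed
      qed
    qed
    then show ?thesis by simp
  qed
qed

lemma not_negligible_carrier: "\<not> negligible (carrier G)"
proof
  assume "negligible (carrier G)"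
  then obtain P where P: "finite P" "\<forall>(H, g)\<in>P. subgroup H G \<and> \<not> finite_index H \<and> g \<in> carrier G"
    "carrier G \<subseteq> (\<Union>(H, g)\<in>P. H #> g)" unfolding negligible_def by blast
  have PG: "subgroup (fst p) G" "\<not> finite_index (fst p)" "snd p \<in> carrier G" if "p \<in> P" for p
    using bspec[OF P(2) that] by (simp_all add: case_prod_beta)
  have "\<exists>H\<in>fst ` P. finite_index H"
  proof (rule coset_cover_finite_index[of "fst ` P" P])
    show "P \<subseteq> fst ` P \<times> carrier G" using PG(3) by (simp add: subset_iff mem_Times_iff)
    show "subgroup H G" if "H \<in> fst ` P" for H using PG(1) that by (elim imageE) simp
  qed (use P(1,3) in simp_all)
  then show False using PG(2) by (elim bexE imageE) simp
qed

text \<open>Finitely many right translates of \<open>H\<close> cover the group, so a negligible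
  \<open>H\<close> would make the whole group negligible. This is what permits the search for
  generic elements inside a subgroup of finite index.\<close>

lemma not_negligible_finite_index:
  assumes "finite_index H" shows "\<not> negligible H"
proof
  assume n: "negligible H"
  obtain R where R: "finite R" "R \<subseteq> carrier G" "\<forall>g\<in>carrier G. \<exists>r\<in>R. g \<otimes> inv r \<in> H"
    using assms unfolding finite_index_def by blast
  have "negligible (\<Union>r\<in>R. {y \<in> carrier G. y \<otimes> inv r \<in> H})"
    using R n by (intro negligible_UN negligible_translate) auto
  then have "negligible (carrier G)" by (rule negligible_mono) (use R in blast)
  then show False using not_negligible_carrier by blast
qed

text \<open>The trivial subgroup of an infinite group has infinite index, and points are its
  cosets.\<close>

lemma negligible_finite:
  assumes "infinite (carrier G)" "finite F" "F \<subseteq> carrier G"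
  shows "negligible F"
proof -
  have "\<not> finite_index {\<one>}"
  proof
    assume "finite_index {\<one>}"
    then obtain R where R: "finite R" "R \<subseteq> carrier G" "\<forall>g\<in>carrier G. \<exists>r\<in>R. g \<otimes> inv r \<in> {\<one>}"
      unfolding finite_index_def by blast
    have "carrier G \<subseteq> R"
    proof
      fix g assume g: "g \<in> carrier G"
      then obtain r where r: "r \<in> R" "g \<otimes> inv r = \<one>" using R by auto
      then have "g = r" using g R(2) inv_equality[of g "inv r"] by auto
      then show "g \<in> R" using r by simp
    qed
    then show False using R assms finite_subset by blast
  qed
  then have "negligible (\<Union>f\<in>F. {\<one>} #> f)"
    using assms triv_subgroup by (intro negligible_UN negligible_coset) auto
  moreover have "F \<subseteq> (\<Union>f\<in>F. {\<one>} #> f)"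
  proof
    fix f assume "f \<in> F"
    then show "f \<in> (\<Union>f\<in>F. {\<one>} #> f)"
      using assms(3) by (intro UN_I[of f]) (simp_all add: r_coset_def subset_iff)
  qed
  ultimately show ?thesis by (rule negligible_mono)
qed

subsection \<open>The FC-center and quadratic equations\<close>

text \<open>The induction built into \<open>generate\<close> splits a word at an arbitrary place;
  proving \<open>Q h \<longrightarrow> Q (h \<otimes> g)\<close> for all \<open>h\<close> reduces it
  to appending single letters.\<close>

lemma generate_right_induct [consumes 2, case_names one mult inv]:
  assumes S: "S \<subseteq> carrier G" and g: "g \<in> generate G S"
    and one: "Q \<one>"
    and mult: "\<And>g s. g \<in> carrier G \<Longrightarrow> s \<in> S \<Longrightarrow> Q g \<Longrightarrow> Q (g \<otimes> s)"
    and inv: "\<And>g s. g \<in> carrier G \<Longrightarrow> s \<in> S \<Longrightarrow> Q g \<Longrightarrow> Q (g \<otimes> inv s)"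
  shows "Q g"
proof -
  have "Q h \<longrightarrow> Q (h \<otimes> g)" if "h \<in> carrier G" for h
    using g that
  proof (induction arbitrary: h rule: generate.induct)
    case (eng a b)
    have ab: "a \<in> carrier G" "b \<in> carrier G"
      using generate_in_carrier[OF S eng.hyps(1)] generate_in_carrier[OF S eng.hyps(2)] by auto
    have "Q h \<longrightarrow> Q (h \<otimes> a)" using eng.IH(1) eng.prems by simp
    moreover have "Q (h \<otimes> a) \<longrightarrow> Q ((h \<otimes> a) \<otimes> b)" using eng.IH(2) eng.prems ab by simp
    ultimately show ?case using ab eng.prems by (simp add: m_assoc)
  next
    case one
    then show ?case by simp
  next
    case (incl s)
    then show ?case using mult by simp
  next
    case (inv s)
    then show ?case using assms(5) by simp
  qed
  then have "Q (\<one> \<otimes> g)" using one by simp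
  then show ?thesis using generate_in_carrier[OF S g] by simp
qed

text \<open>Schreier's lemma: reading a word letter by letter and keeping track of the coset writes
  it as a product of elements \<open>r \<otimes> s \<otimes> inv q\<close> of \<open>H\<close>,
  followed by a representative.\<close>

lemma finite_index_finitely_generated:
  assumes A: "finite A" "A \<subseteq> carrier G" "generate G A = carrier G"
    and H: "subgroup H G" "finite_index H"
  shows "\<exists>B. finite B \<and> B \<subseteq> H \<and> generate G B = H"
proof -
  obtain R where R: "finite R" "R \<subseteq> carrier G" "\<And>g. g \<in> carrier G \<Longrightarrow> \<exists>r\<in>R. g \<otimes> inv r \<in> H"
    using H(2) unfolding finite_index_def by blast
  define R' where "R' = insert \<one> R"
  define S where "S = A \<union> m_inv G ` A"
  \<comment> \<open>\<open>R\<close> is included because the representative left at the end of a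
    word for an element of \<open>H\<close> lies in \<open>H\<close> but may differ from
    \<open>\<one>\<close>.\<close>
  define B where "B = H \<inter> ((\<lambda>(r, s, q). r \<otimes> s \<otimes> inv q) ` (R' \<times> S \<times> R') \<union> R)"
  have R': "finite R'" "R' \<subseteq> carrier G" "finite S" "S \<subseteq> carrier G"
    unfolding R'_def S_def using R(1,2) A(1,2) by auto
  have BH: "B \<subseteq> H" "finite B" unfolding B_def using R(1) R' by auto
  have HG: "H \<subseteq> carrier G" using H subgroup.subset by blast
  have BG: "B \<subseteq> carrier G" using BH HG by blast
  have genG: "generate G B \<subseteq> carrier G" using generate_in_carrier[OF BG] by blast
  have step: "\<exists>r\<in>R'. (g \<otimes> s) \<otimes> inv r \<in> generate G B"
    if gs: "g \<in> carrier G" "s \<in> S" "\<exists>r\<in>R'. g \<otimes> inv r \<in> generate G B" for g s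
  proof -
    obtain r where r: "r \<in> R'" "g \<otimes> inv r \<in> generate G B" using gs(3) by (elim bexE)
    have c: "r \<in> carrier G" "s \<in> carrier G" using r(1) R'(2,4) that(2) by auto
    obtain q where q: "q \<in> R'" "(r \<otimes> s) \<otimes> inv q \<in> H"
      using R(3)[of "r \<otimes> s"] c unfolding R'_def by blast
    then have "r \<otimes> s \<otimes> inv q \<in> B" unfolding B_def using r that(2) by force
    then have "(g \<otimes> inv r) \<otimes> (r \<otimes> s \<otimes> inv q) \<in> generate G B"
      using r(2) by (meson generate.eng generate.incl)
    moreover have "q \<in> carrier G" using q R' by blast
    ultimately have "(g \<otimes> s) \<otimes> inv q \<in> generate G B" using that(1) c by (simp add: group_simps)
    then show ?thesis using q by blast
  qed
  have cover: "\<exists>r\<in>R'. g \<otimes> inv r \<in> generate G B" if "g \<in> carrier G" for g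
  proof -
    have "g \<in> generate G A" using that A by simp
    with A(2) show ?thesis
    proof (induction rule: generate_right_induct)
      case one
      show ?case unfolding R'_def by (intro bexI[of _ \<one>]) (auto intro: generate.one)
    next
      case (mult g s)
      then show ?case using step[of g s] unfolding S_def by blast
    next
      case (inv g s)
      then show ?case using step[of g "inv s"] unfolding S_def by blast
    qed
  qed
  have "H \<subseteq> generate G B"
  proof
    fix h assume h: "h \<in> H"
    then have hG: "h \<in> carrier G" using HG by blast
    obtain r where r: "r \<in> R'" "h \<otimes> inv r \<in> generate G B" using cover[OF hG] by blast
    have rG: "r \<in> carrier G" using r R' by blast
    have gH: "generate G B \<subseteq> H" using generate_subgroup_incl[OF BH(1) H(1)] .
    then have "h \<otimes> inv r \<in> H" using r by blast
    then have "inv (h \<otimes> inv r) \<otimes> h \<in> H" using h H(1) by (simp add: subgroup.m_closed subgroup.m_inv_closed)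
    then have "r \<in> H" using hG rG by (simp add: group_simps)
    then have "r \<in> B \<or> r = \<one>" using r unfolding B_def R'_def by blast
    then have "r \<in> generate G B" by (auto intro: generate.intros)
    then have "(h \<otimes> inv r) \<otimes> r \<in> generate G B" using r(2) by (simp add: generate.eng)
    then show "h \<in> generate G B" using hG rG by (simp add: group_simps)
  qed
  then have "generate G B = H" using generate_subgroup_incl[OF BH(1) H(1)] by blast
  then show ?thesis using BH by blast
qed

text \<open>A further commuting element of order at most two at most doubles the generated
  subgroup.\<close>

lemma finite_generate_exponent_2:
  assumes "finite B" "B \<subseteq> carrier G"
    and "\<And>a b. a \<in> B \<Longrightarrow> b \<in> B \<Longrightarrow> a \<otimes> b = b \<otimes> a" "\<And>a. a \<in> B \<Longrightarrow> a \<otimes> a = \<one>"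
  shows "finite (generate G B)"
  using assms
proof (induction B rule: finite_induct)
  case empty
  have "generate G {} \<subseteq> {\<one>}" using generate_subgroup_incl triv_subgroup by blast
  then show ?case using finite_subset by blast
next
  case (insert b B)
  let ?K = "generate G B"
  have b: "b \<in> carrier G" "B \<subseteq> carrier G" "b \<otimes> b = \<one>" using insert.prems by auto
  have binv: "inv b = b" using b inv_equality by blast
  have sinv: "inv s = s" if "s \<in> B" for s
    using that insert.prems by (auto intro: inv_equality)
  have K: "\<And>a. a \<in> ?K \<Longrightarrow> a \<in> carrier G" using generate_in_carrier b by blast
  have KB: "a \<otimes> s \<in> ?K" if "a \<in> ?K" "s \<in> B" for a s
    using that by (meson generate.eng generate.incl)
  have step: "g \<otimes> s \<in> ?K \<union> (\<lambda>a. a \<otimes> b) ` ?K"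
    if s: "s \<in> insert b B" and g: "g \<in> ?K \<union> (\<lambda>a. a \<otimes> b) ` ?K" for g s
  proof -
    consider "g \<in> ?K" | a where "a \<in> ?K" "g = a \<otimes> b" using g by blast
    then show ?thesis
    proof cases
      case 1
      then show ?thesis using s KB by blast
    next
      case 2
      have aG: "a \<in> carrier G" using 2 K by blast
      show ?thesis
      proof (cases "s = b")
        case True
        then show ?thesis using 2 b aG by (simp add: m_assoc)
      next
        case False
        then have sB: "s \<in> B" using s by blast
        then have sG: "s \<in> carrier G" using b by blast
        have "b \<otimes> s = s \<otimes> b" using insert.prems(2) sB by blast
        then have "g \<otimes> s = (a \<otimes> s) \<otimes> b" using 2 b aG sG by (simp add: m_assoc)
        then show ?thesis using KB 2 sB by blast
      qed
    qed
  qed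
  have "generate G (insert b B) \<subseteq> ?K \<union> (\<lambda>a. a \<otimes> b) ` ?K"
  proof
    fix g assume "g \<in> generate G (insert b B)"
    with insert.prems(1) show "g \<in> ?K \<union> (\<lambda>a. a \<otimes> b) ` ?K"
    proof (induction rule: generate_right_induct)
      case one
      show ?case using generate.one by blast
    next
      case (mult g s)
      then show ?case using step by blast
    next
      case (inv g s)
      moreover have "inv s = s" using inv binv sinv by blast
      ultimately show ?case using step by metis
    qed
  qed
  moreover have "finite ?K" using insert by blast
  ultimately show ?case by (meson finite_UnI finite_imageI finite_subset)
qed

section \<open>Centralizers, the FC-center and equations in one unknown\<close>

definition centralizer :: "'a \<Rightarrow> 'a set" where
  "centralizer a = {x \<in> carrier G. x \<otimes> a = a \<otimes> x}"

lemma subgroup_centralizer: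
  assumes a: "a \<in> carrier G" shows "subgroup (centralizer a) G"
proof (rule subgroupI)
  show "centralizer a \<noteq> {}" unfolding centralizer_def using a by auto
  show "inv x \<in> centralizer a" if "x \<in> centralizer a" for x
  proof -
    have x: "x \<in> carrier G" "x \<otimes> a = a \<otimes> x" using that unfolding centralizer_def by auto
    have "inv x \<otimes> (x \<otimes> a) \<otimes> inv x = inv x \<otimes> (a \<otimes> x) \<otimes> inv x" using x by simp
    then show ?thesis using x(1) a unfolding centralizer_def by (simp add: group_simps)
  qed
  show "x \<otimes> y \<in> centralizer a" if "x \<in> centralizer a" "y \<in> centralizer a" for x y
    using that a unfolding centralizer_def by (simp add: m_assoc) (simp add: m_assoc[symmetric])
qed (auto simp: centralizer_def)

text \<open>These are the elements with finitely many conjugates, described through the index of the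
  centralizer to match the language of coset covers.\<close>

definition fc_center :: "'a set" where
  "fc_center = {a \<in> carrier G. finite_index (centralizer a)}"

lemma subgroup_fc_center: "subgroup fc_center G"
proof (rule subgroupI)
  have "centralizer \<one> = carrier G" unfolding centralizer_def by auto
  then have "\<one> \<in> fc_center" unfolding fc_center_def using finite_index_carrier by simp
  then show "fc_center \<noteq> {}" by blast
  show "inv a \<in> fc_center" if "a \<in> fc_center" for a
  proof -
    have a: "a \<in> carrier G" "finite_index (centralizer a)" using that unfolding fc_center_def by auto
    have "centralizer a \<subseteq> centralizer (inv a)"
    proof
      fix x assume "x \<in> centralizer a"
      then have x: "x \<in> carrier G" "x \<otimes> a = a \<otimes> x" unfolding centralizer_def by auto
      have "inv a \<otimes> (x \<otimes> a) \<otimes> inv a = inv a \<otimes> (a \<otimes> x) \<otimes> inv a" using x by simp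
      then show "x \<in> centralizer (inv a)"
        using x(1) a unfolding centralizer_def by (simp add: group_simps)
    qed
    then have "finite_index (centralizer (inv a))" using a(2) by (metis finite_index_mono)
    then show ?thesis using a(1) unfolding fc_center_def by simp
  qed
  show "a \<otimes> b \<in> fc_center" if "a \<in> fc_center" "b \<in> fc_center" for a b
  proof -
    have ab: "a \<in> carrier G" "finite_index (centralizer a)" "b \<in> carrier G" "finite_index (centralizer b)"
      using that unfolding fc_center_def by auto
    have "centralizer a \<inter> centralizer b \<subseteq> centralizer (a \<otimes> b)"
    proof
      fix x assume "x \<in> centralizer a \<inter> centralizer b"
      then have x: "x \<in> carrier G" "x \<otimes> a = a \<otimes> x" "x \<otimes> b = b \<otimes> x"
        unfolding centralizer_def by auto
      have "x \<otimes> (a \<otimes> b) = (a \<otimes> x) \<otimes> b" using x ab by (simp flip: m_assoc)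
      also have "\<dots> = a \<otimes> b \<otimes> x" using x ab by (simp add: m_assoc)
      finally show "x \<in> centralizer (a \<otimes> b)" using x(1) unfolding centralizer_def by simp
    qed
    moreover have "finite_index (centralizer a \<inter> centralizer b)"
      using ab by (intro finite_index_Int subgroup_centralizer)
    ultimately have "finite_index (centralizer (a \<otimes> b))" by (metis finite_index_mono)
    then show ?thesis using ab unfolding fc_center_def by simp
  qed
qed (auto simp: fc_center_def)

text \<open>Conjugation by \<open>g\<close> carries the centralizer of \<open>a\<close> to that of
  the conjugate; the representatives \<open>r\<close> become \<open>g \<otimes> r\<close>.\<close>

lemma fc_center_conj:
  assumes a: "a \<in> fc_center" and g: "g \<in> carrier G"
  shows "g \<otimes> a \<otimes> inv g \<in> fc_center"
proof -
  have aG: "a \<in> carrier G" using a unfolding fc_center_def by simp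
  obtain R where R: "finite R" "R \<subseteq> carrier G" "\<And>k. k \<in> carrier G \<Longrightarrow> \<exists>r\<in>R. k \<otimes> inv r \<in> centralizer a"
    using a unfolding fc_center_def finite_index_def by blast
  have "finite_index (centralizer (g \<otimes> a \<otimes> inv g))"
    unfolding finite_index_def
  proof (intro exI[of _ "(\<lambda>r. g \<otimes> r) ` R"] conjI ballI)
    fix k assume k: "k \<in> carrier G"
    then obtain r where r: "r \<in> R" "(inv g \<otimes> k) \<otimes> inv r \<in> centralizer a"
      using R(3)[of "inv g \<otimes> k"] g by auto
    have rG: "r \<in> carrier G" using r R by blast
    have e: "(inv g \<otimes> k \<otimes> inv r) \<otimes> a = a \<otimes> (inv g \<otimes> k \<otimes> inv r)"
      using r unfolding centralizer_def by simp
    have "g \<otimes> ((inv g \<otimes> k \<otimes> inv r) \<otimes> a) \<otimes> inv g = g \<otimes> (a \<otimes> (inv g \<otimes> k \<otimes> inv r)) \<otimes> inv g"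
      using e by simp
    then have "k \<otimes> inv (g \<otimes> r) \<in> centralizer (g \<otimes> a \<otimes> inv g)"
      using k rG g aG unfolding centralizer_def by (simp add: group_simps)
    then show "\<exists>r\<in>(\<lambda>r. g \<otimes> r) ` R. k \<otimes> inv r \<in> centralizer (g \<otimes> a \<otimes> inv g)"
      using r by blast
  qed (use R g in auto)
  then show ?thesis using aG g unfolding fc_center_def by simp
qed

text \<open>For two solutions \<open>x\<close> and \<open>x0\<close> the element
  \<open>x \<otimes> inv x0\<close> commutes with \<open>b\<close>, so the solutions lie in one
  coset of the centralizer of \<open>b\<close>. That centralizer has infinite index because the
  conjugate \<open>a\<close> of \<open>b\<close> is outside the FC-center.\<close>

lemma negligible_conj:
  assumes a: "a \<in> carrier G" "a \<notin> fc_center"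
  shows "negligible {x \<in> carrier G. x \<otimes> a \<otimes> inv x = b}"
proof (cases "\<exists>x0\<in>carrier G. x0 \<otimes> a \<otimes> inv x0 = b")
  case False
  then show ?thesis by (intro negligible_mono[OF negligible_empty]) blast
next
  case True
  then obtain x0 where x0: "x0 \<in> carrier G" "x0 \<otimes> a \<otimes> inv x0 = b" by blast
  then have b: "b \<in> carrier G" using a by auto
  have "inv x0 \<otimes> b \<otimes> inv (inv x0) = a" using x0 a by (auto simp: group_simps)
  then have "b \<notin> fc_center" using fc_center_conj[of b "inv x0"] a x0 by auto
  then have "\<not> finite_index (centralizer b)" using b unfolding fc_center_def by simp
  then have "negligible (centralizer b #> x0)"
    using b x0 by (intro negligible_coset subgroup_centralizer)
  moreover have "{x \<in> carrier G. x \<otimes> a \<otimes> inv x = b} \<subseteq> centralizer b #> x0"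
  proof
    fix x assume "x \<in> {x \<in> carrier G. x \<otimes> a \<otimes> inv x = b}"
    then have x: "x \<in> carrier G" "x \<otimes> a \<otimes> inv x = b" by auto
    have "x \<otimes> inv x0 \<otimes> (x0 \<otimes> a \<otimes> inv x0) = x \<otimes> a \<otimes> inv x \<otimes> (x \<otimes> inv x0)"
      using x(1) x0(1) a(1) by (simp add: group_simps)
    then have "x \<otimes> inv x0 \<otimes> b = b \<otimes> (x \<otimes> inv x0)" using x x0(2) by simp
    then have "x \<otimes> inv x0 \<in> centralizer b" using x(1) x0(1) unfolding centralizer_def by simp
    moreover have "x = (x \<otimes> inv x0) \<otimes> x0" using x(1) x0(1) by (simp add: group_simps)
    ultimately show "x \<in> centralizer b #> x0" by (auto simp: r_coset_def)
  qed
  ultimately show ?thesis by (rule negligible_mono)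
qed

text \<open>If \<open>y g\<close> and \<open>y h\<close> both solve \<open>x a x = b\<close>, then \<open>a y g\<close> inverts \<open>g\<inverse> h\<close>. So all such \<open>y\<close> lie
  in one coset of a centralizer, while among more elements \<open>y g\<close> than equations two solve the same
  equation.\<close>
lemma not_covered_by_quadratics:
  assumes fc: "\<not> finite_index fc_center" and P: "finite P" "P \<subseteq> carrier G \<times> carrier G"
    and M: "negligible M"
  shows "\<not> carrier G \<subseteq> M \<union> {x. \<exists>(a, b)\<in>P. x \<otimes> a \<otimes> x = b}"
proof
  assume cov: "carrier G \<subseteq> M \<union> {x. \<exists>(a, b)\<in>P. x \<otimes> a \<otimes> x = b}"
  \<comment> \<open>One element more than there are equations, for the pigeonhole principle.\<close>
  obtain R where R: "finite R" "card R = Suc (card P)" "R \<subseteq> carrier G"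
    "\<And>r q. r \<in> R \<Longrightarrow> q \<in> R \<Longrightarrow> r \<noteq> q \<Longrightarrow> r \<otimes> inv q \<notin> fc_center"
    using infinite_index_separated[OF subgroup_fc_center fc, of "Suc (card P)"] by blast
  define Y where "Y g h p = {y \<in> carrier G. y \<otimes> g \<otimes> fst p \<otimes> (y \<otimes> g) = snd p \<and>
     y \<otimes> h \<otimes> fst p \<otimes> (y \<otimes> h) = snd p}" for g h p
  have Y: "negligible (Y g h p)" if gh: "g \<in> R" "h \<in> R" "g \<noteq> h" and p: "p \<in> P" for g h p
  proof (cases "Y g h p = {}")
    case True
    then show ?thesis using negligible_empty by simp
  next
    case False
    then obtain z where z: "z \<in> Y g h p" by blast
    define a where "a = fst p"
    have G: "g \<in> carrier G" "h \<in> carrier G" "a \<in> carrier G" using gh R(3) P(2) p unfolding a_def by auto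
    define v where "v = inv g \<otimes> h"
    have vG: "v \<in> carrier G" using G unfolding v_def by simp
    have inverts: "v \<otimes> (a \<otimes> y \<otimes> g) \<otimes> v = a \<otimes> y \<otimes> g" if "y \<in> Y g h p" for y
    proof -
      have y: "y \<in> carrier G" "y \<otimes> g \<otimes> a \<otimes> (y \<otimes> g) = y \<otimes> h \<otimes> a \<otimes> (y \<otimes> h)"
        using that unfolding Y_def a_def by auto
      have "inv g \<otimes> inv y \<otimes> (y \<otimes> g \<otimes> a \<otimes> (y \<otimes> g)) = inv g \<otimes> inv y \<otimes> (y \<otimes> h \<otimes> a \<otimes> (y \<otimes> h))"
        using y by simp
      then have "a \<otimes> y \<otimes> g = v \<otimes> (a \<otimes> y \<otimes> h)" using y(1) G unfolding v_def by (simp add: group_simps)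
      moreover have "v \<otimes> (a \<otimes> y \<otimes> g) \<otimes> v = v \<otimes> (a \<otimes> y \<otimes> h)"
        using y(1) G unfolding v_def by (simp add: group_simps)
      ultimately show ?thesis by simp
    qed
    \<comment> \<open>Two elements that invert \<open>v\<close> by conjugation differ by an element
      commuting with \<open>v\<close>. Here \<open>inv u \<otimes> w\<close> is the conjugate of
      \<open>inv z \<otimes> y\<close> by \<open>inv g\<close>, and conjugation by \<open>g\<close>
      turns \<open>v\<close> into \<open>h \<otimes> inv g\<close>, which is outside the FC-center
      by the choice of \<open>R\<close>.\<close>
    have commutes: "(inv z \<otimes> y) \<otimes> (h \<otimes> inv g) = (h \<otimes> inv g) \<otimes> (inv z \<otimes> y)" if y: "y \<in> Y g h p" for y
    proof -
      define w u where "w = a \<otimes> y \<otimes> g" and "u = a \<otimes> z \<otimes> g"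
      have yz: "y \<in> carrier G" "z \<in> carrier G" using y z unfolding Y_def by auto
      then have wu: "w \<in> carrier G" "u \<in> carrier G" unfolding w_def u_def using G by auto
      have "v \<otimes> w \<otimes> v = w" "v \<otimes> u \<otimes> v = u" using inverts y z unfolding w_def u_def by auto
      then have "v \<otimes> (inv u \<otimes> w) = v \<otimes> (inv (v \<otimes> u \<otimes> v) \<otimes> (v \<otimes> w \<otimes> v))" by simp
      also have "\<dots> = inv u \<otimes> w \<otimes> v" using wu vG by (simp add: group_simps)
      finally have "v \<otimes> (inv u \<otimes> w) = inv u \<otimes> w \<otimes> v" .
      then have "g \<otimes> (v \<otimes> (inv u \<otimes> w)) \<otimes> inv g = g \<otimes> (inv u \<otimes> w \<otimes> v) \<otimes> inv g" by simp
      then show ?thesis using yz G unfolding u_def w_def v_def by (simp add: group_simps)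
    qed
    define c where "c = h \<otimes> inv g"
    have zG: "z \<in> carrier G" using z unfolding Y_def by simp
    have c: "c \<in> carrier G" "c \<notin> fc_center" using G R(4) gh unfolding c_def by auto
    have "Y g h p \<subseteq> {x \<in> carrier G. x \<otimes> c \<otimes> inv x = z \<otimes> c \<otimes> inv z}"
    proof
      fix y assume y: "y \<in> Y g h p"
      then have yG: "y \<in> carrier G" unfolding Y_def by simp
      have "z \<otimes> ((inv z \<otimes> y) \<otimes> c) \<otimes> inv y = z \<otimes> (c \<otimes> (inv z \<otimes> y)) \<otimes> inv y"
        using commutes[OF y] unfolding c_def by simp
      then show "y \<in> {x \<in> carrier G. x \<otimes> c \<otimes> inv x = z \<otimes> c \<otimes> inv z}"
        using yG zG c(1) by (simp add: group_simps)
    qed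
    then show ?thesis by (rule negligible_mono[OF negligible_conj[OF c]])
  qed
  define N where "N = (\<Union>g\<in>R. {y \<in> carrier G. y \<otimes> g \<in> M}) \<union>
     (\<Union>(g, h, p)\<in>{(g, h, p). g \<in> R \<and> h \<in> R \<and> g \<noteq> h \<and> p \<in> P}. Y g h p)"
  have "negligible N"
    unfolding N_def
  proof (intro negligible_Un negligible_UN)
    show "finite {(g, h, p). g \<in> R \<and> h \<in> R \<and> g \<noteq> h \<and> p \<in> P}"
      by (rule finite_subset[of _ "R \<times> R \<times> P"]) (use R(1) P(1) in auto)
  qed (use R Y M negligible_translate in auto)
  moreover have "carrier G \<subseteq> N"
  proof
    fix y assume y: "y \<in> carrier G"
    show "y \<in> N"
    proof (cases "\<exists>g\<in>R. y \<otimes> g \<in> M")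
      case True
      then show ?thesis using y unfolding N_def by blast
    next
      case False
      have "\<exists>p. p \<in> P \<and> y \<otimes> g \<otimes> fst p \<otimes> (y \<otimes> g) = snd p" if g: "g \<in> R" for g
      proof -
        have "y \<otimes> g \<in> carrier G" using y g R(3) by (simp add: subset_iff)
        then have "y \<otimes> g \<in> M \<union> {x. \<exists>(a, b)\<in>P. x \<otimes> a \<otimes> x = b}" using cov by (rule subsetD[rotated])
        then obtain a b where "(a, b) \<in> P" "y \<otimes> g \<otimes> a \<otimes> (y \<otimes> g) = b" using False g by auto
        then show ?thesis by (intro exI[of _ "(a, b)"]) simp
      qed
      then obtain f where f: "\<And>g. g \<in> R \<Longrightarrow> f g \<in> P \<and> y \<otimes> g \<otimes> fst (f g) \<otimes> (y \<otimes> g) = snd (f g)"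
        by metis
      have "\<not> inj_on f R"
      proof
        assume "inj_on f R"
        then have "card R \<le> card P" using f P(1) by (intro card_inj_on_le[of f]) auto
        then show False using R(2) by simp
      qed
      then obtain g h where gh: "g \<in> R" "h \<in> R" "g \<noteq> h" "f g = f h" unfolding inj_on_def by blast
      then have "y \<in> Y g h (f g)" using f[of g] f[of h] y unfolding Y_def by simp
      then show ?thesis using gh f unfolding N_def by blast
    qed
  qed
  ultimately have "negligible (carrier G)" by (rule negligible_mono)
  then show False using not_negligible_carrier by simp
qed

subsection \<open>Generic elements\<close>

text \<open>An \<open>a\<close> in the FC-center commutes with a subgroup of finite index, on which
  \<open>x \<otimes> a \<otimes> inv x = b\<close> forces \<open>b = a\<close>; for any other
  \<open>a\<close> the solutions are negligible. Returning \<open>N\<close> and \<open>Z\<close>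
  instead of a single \<open>x\<close> leaves room for the quadratic conditions.\<close>

lemma conj_generic:
  assumes inf: "infinite (carrier G)" and F: "finite F" "F \<subseteq> carrier G"
  obtains N Z where "negligible N" "subgroup Z G" "finite_index Z"
    "\<And>x. x \<in> Z \<Longrightarrow> x \<notin> N \<Longrightarrow> x \<notin> F"
    "\<And>x a b. x \<in> Z \<Longrightarrow> x \<notin> N \<Longrightarrow> a \<in> F \<Longrightarrow> b \<in> F \<Longrightarrow> x \<otimes> a \<otimes> inv x = b \<Longrightarrow> a = b"
proof -
  define Z where "Z = carrier G \<inter> (\<Inter>a\<in>F \<inter> fc_center. centralizer a)"
  define N where "N = F \<union> (\<Union>p\<in>(F - fc_center) \<times> F. {x \<in> carrier G. x \<otimes> fst p \<otimes> inv x = snd p})"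
  have Z: "finite_index Z \<and> subgroup Z G"
    unfolding Z_def
  proof (rule finite_index_INT)
    show "finite (F \<inter> fc_center)" using F(1) by simp
  qed (auto simp: fc_center_def subgroup_centralizer)
  have N: "negligible N"
    unfolding N_def
  proof (intro negligible_Un negligible_UN)
    show "negligible F" using negligible_finite[OF inf F] .
    show "finite ((F - fc_center) \<times> F)" using F(1) by simp
    show "negligible {x \<in> carrier G. x \<otimes> fst p \<otimes> inv x = snd p}"
      if "p \<in> (F - fc_center) \<times> F" for p
      using that F(2) by (intro negligible_conj) auto
  qed
  have conj: "a = b" if x: "x \<in> Z" "x \<notin> N" and a: "a \<in> F" "b \<in> F" "x \<otimes> a \<otimes> inv x = b" for x a b
  proof (cases "a \<in> fc_center")
    case True
    then have "x \<in> carrier G" "x \<otimes> a = a \<otimes> x"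
      using x(1) a(1) unfolding Z_def centralizer_def by auto
    moreover have "a \<in> carrier G" using F(2) a(1) by blast
    ultimately show ?thesis using a(3) by (simp add: m_assoc)
  next
    case False
    then have "(a, b) \<in> (F - fc_center) \<times> F" using a by simp
    moreover have "x \<in> {x \<in> carrier G. x \<otimes> fst (a, b) \<otimes> inv x = snd (a, b)}"
      using x(1) a(3) unfolding Z_def by simp
    ultimately have "x \<in> N" unfolding N_def by (intro UnI2 UN_I)
    then show ?thesis using x(2) by simp
  qed
  have notF: "x \<notin> F" if "x \<notin> N" for x using that unfolding N_def by simp
  show thesis
  proof (rule that[OF N conjunct2[OF Z] conjunct1[OF Z]])
    show "x \<notin> F" if "x \<in> Z" "x \<notin> N" for x using notF that by simp
    show "a = b" if "x \<in> Z" "x \<notin> N" "a \<in> F" "b \<in> F" "x \<otimes> a \<otimes> inv x = b" for x a b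
      using conj[OF that] .
  qed
qed

text \<open>By Schreier's lemma the FC-center is finitely generated, so a subgroup of finite index
  centralizes all its generators. The intersection of the two lies in the center of the
  FC-center.\<close>

lemma fc_center_abelian_finite_index:
  assumes fg: "finite S" "S \<subseteq> carrier G" "generate G S = carrier G" and fc: "finite_index fc_center"
  shows "\<exists>A. subgroup A G \<and> finite_index A \<and> (\<forall>x\<in>A. \<forall>y\<in>A. x \<otimes> y = y \<otimes> x)"
proof -
  obtain B where B: "finite B" "B \<subseteq> fc_center" "generate G B = fc_center"
    using finite_index_finitely_generated[OF fg subgroup_fc_center fc] by blast
  have BG: "b \<in> carrier G" "finite_index (centralizer b)" if "b \<in> B" for b
    using B(2) that unfolding fc_center_def by auto
  define C where "C = carrier G \<inter> (\<Inter>b\<in>B. centralizer b)"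
  have C: "finite_index C \<and> subgroup C G"
    unfolding C_def using B(1) BG by (intro finite_index_INT subgroup_centralizer)
  have "x \<otimes> y = y \<otimes> x" if "x \<in> fc_center \<inter> C" "y \<in> fc_center \<inter> C" for x y
  proof -
    have xG: "x \<in> carrier G" using that C_def by simp
    have "B \<subseteq> centralizer x" using that(1) BG(1) unfolding C_def centralizer_def by auto
    then have "generate G B \<subseteq> centralizer x"
      by (rule generate_subgroup_incl[OF _ subgroup_centralizer[OF xG]])
    then have "fc_center \<subseteq> centralizer x" using B(3) by simp
    then have "y \<in> centralizer x" using that(2) by blast
    then show ?thesis unfolding centralizer_def by simp
  qed
  moreover have "finite_index (fc_center \<inter> C)" "subgroup (fc_center \<inter> C) G"
    using C fc subgroup_fc_center by (auto intro: finite_index_Int subgroups_Inter_pair)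
  ultimately show ?thesis by (intro exI[of _ "fc_center \<inter> C"]) simp
qed

text \<open>\<open>V\<close> is the set of labels \<open>a\<close> at which
  \<open>x \<otimes> a \<otimes> x = a\<close> is accepted. Commuting with elements of
  \<open>F\<close> is always accepted, as central elements show that it must be.\<close>

definition generic :: "'a set \<Rightarrow> 'a set \<Rightarrow> 'a \<Rightarrow> bool" where
  "generic V F x \<longleftrightarrow> x \<in> carrier G \<and> x \<notin> F \<and>
     (\<forall>a\<in>F. \<forall>b\<in>F. (x \<otimes> a \<otimes> x = b \<longrightarrow> a = b \<and> a \<in> V) \<and> (x \<otimes> a \<otimes> inv x = b \<longrightarrow> a = b))"

text \<open>Without a generic element, all of \<open>Z\<close> outside \<open>N\<close> would solve
  quadratic equations; spreading this over the cosets of \<open>Z\<close> would cover the whole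
  group.\<close>

lemma ex_generic_fc_infinite_index:
  assumes inf: "infinite (carrier G)" and fc: "\<not> finite_index fc_center"
    and F: "finite F" "F \<subseteq> carrier G"
  shows "\<exists>x. generic {} F x"
proof (rule ccontr)
  assume none: "\<not> (\<exists>x. generic {} F x)"
  obtain N Z where N: "negligible N" and Z: "subgroup Z G" "finite_index Z"
    and NF: "\<And>x. x \<in> Z \<Longrightarrow> x \<notin> N \<Longrightarrow> x \<notin> F"
    and conj: "\<And>x a b. x \<in> Z \<Longrightarrow> x \<notin> N \<Longrightarrow> a \<in> F \<Longrightarrow> b \<in> F \<Longrightarrow> x \<otimes> a \<otimes> inv x = b \<Longrightarrow> a = b"
    by (rule conj_generic[OF inf F], rule that, assumption+)
  have quad: "\<exists>a\<in>F. \<exists>b\<in>F. x \<otimes> a \<otimes> x = b" if x: "x \<in> Z" "x \<notin> N" for x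
  proof (rule ccontr)
    assume "\<not> (\<exists>a\<in>F. \<exists>b\<in>F. x \<otimes> a \<otimes> x = b)"
    then have no: "x \<otimes> a \<otimes> x \<noteq> b" if "a \<in> F" "b \<in> F" for a b using that by blast
    have "generic {} F x"
      unfolding generic_def
    proof (intro conjI ballI impI)
      show "x \<in> carrier G" by (rule subgroup.mem_carrier[OF Z(1) x(1)])
      show "x \<notin> F" by (rule NF[OF x])
      show "a = b" if "a \<in> F" "b \<in> F" "x \<otimes> a \<otimes> inv x = b" for a b by (rule conj[OF x that])
    qed (use no in simp_all)
    then show False using none by simp
  qed
  obtain R where R: "finite R" "R \<subseteq> carrier G" "\<And>g. g \<in> carrier G \<Longrightarrow> \<exists>r\<in>R. g \<otimes> inv r \<in> Z"
    using Z(2) unfolding finite_index_def by blast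
  define M where "M = (\<Union>r\<in>R. {y \<in> carrier G. y \<otimes> inv r \<in> N})"
  \<comment> \<open>For \<open>g = y \<otimes> r\<close> with \<open>y \<in> Z\<close>, the equation
    \<open>y \<otimes> a \<otimes> y = b\<close> becomes
    \<open>g \<otimes> (inv r \<otimes> a) \<otimes> g = b \<otimes> r\<close>, again quadratic in
    \<open>g\<close>.\<close>
  define P where "P = (\<lambda>(r, a, b). (inv r \<otimes> a, b \<otimes> r)) ` (R \<times> F \<times> F)"
  have "\<not> carrier G \<subseteq> M \<union> {x. \<exists>(a, b)\<in>P. x \<otimes> a \<otimes> x = b}"
  proof (rule not_covered_by_quadratics[OF fc])
    show "finite P" unfolding P_def using R(1) F(1) by simp
    show "P \<subseteq> carrier G \<times> carrier G" unfolding P_def using R(2) F(2) by (auto simp: subset_iff)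
    show "negligible M"
      unfolding M_def using R(1,2) N by (intro negligible_UN negligible_translate) auto
  qed
  then obtain g where g: "g \<in> carrier G" "g \<notin> M" "\<not> (\<exists>(a, b)\<in>P. g \<otimes> a \<otimes> g = b)" by blast
  obtain r where r: "r \<in> R" "g \<otimes> inv r \<in> Z" using R(3)[OF g(1)] by blast
  have "g \<otimes> inv r \<notin> N" using g r(1) unfolding M_def by blast
  then obtain a b where ab: "a \<in> F" "b \<in> F" "(g \<otimes> inv r) \<otimes> a \<otimes> (g \<otimes> inv r) = b"
    using quad[OF r(2)] by blast
  have G: "r \<in> carrier G" "a \<in> carrier G" "b \<in> carrier G" using r(1) R(2) ab F(2) by auto
  have "g \<otimes> (inv r \<otimes> a) \<otimes> g = (g \<otimes> inv r) \<otimes> a \<otimes> (g \<otimes> inv r) \<otimes> r"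
    using g(1) G by (simp add: group_simps)
  then have "g \<otimes> (inv r \<otimes> a) \<otimes> g = b \<otimes> r" using ab(3) by simp
  moreover have "(inv r \<otimes> a, b \<otimes> r) \<in> P" unfolding P_def using r(1) ab(1,2) by force
  ultimately show False using g(3) by blast
qed

lemma ex_generic_abelian_finite_index:
  assumes inf: "infinite (carrier G)"
    and fg: "finite S" "S \<subseteq> carrier G" "generate G S = carrier G"
    and A: "subgroup A G" "finite_index A" and comm: "\<And>x y. x \<in> A \<Longrightarrow> y \<in> A \<Longrightarrow> x \<otimes> y = y \<otimes> x"
  shows "\<exists>V. \<one> \<notin> V \<and> (\<forall>a\<in>V. inv a \<in> V \<and> a \<otimes> a \<notin> V) \<and>
           (\<forall>F. finite F \<and> F \<subseteq> carrier G \<longrightarrow> (\<exists>x. generic V F x))"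
proof -
  \<comment> \<open>\<open>K a\<close> consists of the elements of \<open>A\<close> inverted by
    conjugation with \<open>a\<close>; it is a subgroup as \<open>A\<close> is abelian.
    \<open>V\<close> collects the \<open>a\<close> that invert a subgroup of finite index, where the
    coincidence cannot be discarded as negligible.\<close>
  define K where "K a = {x \<in> A. x \<otimes> a \<otimes> x = a}" for a
  define V where "V = {a \<in> carrier G. finite_index (K a)}"
  have AG: "x \<in> carrier G" if "x \<in> A" for x using A(1) that by (rule subgroup.mem_carrier)
  have K_swap: "a \<otimes> x = inv x \<otimes> a" "a \<otimes> inv x = x \<otimes> a" if a: "a \<in> carrier G" and x: "x \<in> K a" for a x
  proof -
    have x': "x \<in> carrier G" "x \<otimes> a \<otimes> x = a" using x AG unfolding K_def by auto
    have "a \<otimes> x = inv x \<otimes> (x \<otimes> a \<otimes> x)" using x'(1) a by (simp add: group_simps)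
    then show "a \<otimes> x = inv x \<otimes> a" using x'(2) by simp
    have "x \<otimes> a = (x \<otimes> a \<otimes> x) \<otimes> inv x" using x'(1) a by (simp add: group_simps)
    then show "a \<otimes> inv x = x \<otimes> a" using x'(2) by simp
  qed
  have K: "subgroup (K a) G" if a: "a \<in> carrier G" for a
  proof (rule subgroupI)
    show "K a \<subseteq> carrier G" unfolding K_def using AG by blast
    have "\<one> \<in> K a" unfolding K_def using a subgroup.one_closed[OF A(1)] by simp
    then show "K a \<noteq> {}" by blast
    show "inv x \<in> K a" if x: "x \<in> K a" for x
    proof -
      have x': "x \<in> carrier G" "inv x \<in> A"
        using x AG subgroup.m_inv_closed[OF A(1)] unfolding K_def by auto
      have "inv x \<otimes> a \<otimes> inv x = inv x \<otimes> (a \<otimes> inv x)" using x' a by (simp add: m_assoc)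
      also have "\<dots> = a" using K_swap(2)[OF a x] x' a by (simp add: group_simps)
      finally show ?thesis using x'(2) unfolding K_def by simp
    qed
    show "x \<otimes> y \<in> K a" if x: "x \<in> K a" and y: "y \<in> K a" for x y
    proof -
      have xy: "x \<in> A" "y \<in> A" "y \<otimes> a \<otimes> y = a" using x y unfolding K_def by auto
      have "x \<otimes> y \<otimes> a \<otimes> (x \<otimes> y) = y \<otimes> x \<otimes> (a \<otimes> x) \<otimes> y"
        using comm[OF xy(1,2)] AG[OF xy(1)] AG[OF xy(2)] a by (simp add: m_assoc)
      also have "\<dots> = y \<otimes> x \<otimes> (inv x \<otimes> a) \<otimes> y" using K_swap(1)[OF a x] by simp
      also have "\<dots> = y \<otimes> a \<otimes> y" using AG[OF xy(1)] AG[OF xy(2)] a by (simp add: group_simps)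
      finally show ?thesis using xy subgroup.m_closed[OF A(1)] unfolding K_def by simp
    qed
  qed
  \<comment> \<open>\<open>K \<one>\<close> is the 2-torsion of \<open>A\<close>. If it had finite
    index, it would be finitely generated and hence finite, inside an infinite group.\<close>
  have one: "\<one> \<notin> V"
  proof
    assume "\<one> \<in> V"
    then have fi: "finite_index (K \<one>)" unfolding V_def by simp
    obtain B where B: "finite B" "B \<subseteq> K \<one>" "generate G B = K \<one>"
      using finite_index_finitely_generated[OF fg K[OF one_closed] fi] by blast
    have "a \<otimes> b = b \<otimes> a" if "a \<in> B" "b \<in> B" for a b
      using that B(2) comm unfolding K_def by auto
    moreover have "a \<otimes> a = \<one>" if "a \<in> B" for a
      using that B(2) AG unfolding K_def by auto
    moreover have BG: "B \<subseteq> carrier G" using B(2) subgroup.subset[OF K[OF one_closed]] by simp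
    ultimately have "finite (K \<one>)" using finite_generate_exponent_2[OF B(1)] B(3) by simp
    then have "negligible (K \<one>)"
      using negligible_finite[OF inf] subgroup.subset[OF K[OF one_closed]] by simp
    then show False using not_negligible_finite_index[OF fi] by simp
  qed
  have inv: "inv a \<in> V" if "a \<in> V" for a
  proof -
    have a: "a \<in> carrier G" "finite_index (K a)" using that unfolding V_def by auto
    have "K a \<subseteq> K (inv a)"
    proof
      fix x assume x: "x \<in> K a"
      then have x': "x \<in> carrier G" "x \<in> A" using AG unfolding K_def by auto
      have "x \<otimes> inv a \<otimes> x = inv (inv x \<otimes> (a \<otimes> inv x))"
        using x'(1) a(1) by (simp add: group_simps)
      also have "\<dots> = inv a" using K_swap(2)[OF a(1) x] x' a by (simp add: group_simps)
      finally show "x \<in> K (inv a)" using x'(2) unfolding K_def by simp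
    qed
    then have "finite_index (K (inv a))" by (rule finite_index_mono[OF a(2)])
    then show ?thesis unfolding V_def using a(1) by simp
  qed
  \<comment> \<open>What \<open>a\<close> inverts is fixed under conjugation by
    \<open>a \<otimes> a\<close>; if that inverts it too, it has order at most two.\<close>
  have sq: "a \<otimes> a \<notin> V" if "a \<in> V" for a
  proof
    assume "a \<otimes> a \<in> V"
    then have a: "a \<in> carrier G" "finite_index (K a)" "finite_index (K (a \<otimes> a))"
      using that unfolding V_def by auto
    have "K a \<inter> K (a \<otimes> a) \<subseteq> K \<one>"
    proof
      fix x assume x: "x \<in> K a \<inter> K (a \<otimes> a)"
      then have xA: "x \<in> A" "x \<otimes> (a \<otimes> a) \<otimes> x = a \<otimes> a" unfolding K_def by auto
      have xG: "x \<in> carrier G" using xA AG by simp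
      have "x \<otimes> (a \<otimes> a) \<otimes> x = x \<otimes> a \<otimes> (a \<otimes> x)" using xG a(1) by (simp add: m_assoc)
      also have "\<dots> = x \<otimes> (a \<otimes> inv x) \<otimes> a" using K_swap(1)[OF a(1)] x xG a(1) by (simp add: m_assoc)
      also have "\<dots> = (x \<otimes> x) \<otimes> (a \<otimes> a)" using K_swap(2)[OF a(1)] x xG a(1) by (simp add: m_assoc)
      finally have "(x \<otimes> x) \<otimes> (a \<otimes> a) = a \<otimes> a" using xA(2) by simp
      then have "x \<otimes> x = \<one>" using xG a(1) by simp
      then show "x \<in> K \<one>" using xA(1) xG unfolding K_def by simp
    qed
    then have "finite_index (K \<one>)"
      using finite_index_mono[OF finite_index_Int[OF K[of a] K[of "a \<otimes> a"] a(2,3)]] a(1) by simp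
    then show False using one unfolding V_def by simp
  qed
  \<comment> \<open>If \<open>x\<close> and \<open>z\<close> in \<open>A\<close> are both solutions,
    then \<open>x \<otimes> inv z\<close> lies in \<open>K a\<close>.\<close>
  have quad: "negligible {x \<in> A. x \<otimes> a \<otimes> x = b}" if a: "a \<in> carrier G" "a \<notin> V" for a b
  proof (cases "\<exists>z. z \<in> A \<and> z \<otimes> a \<otimes> z = b")
    case False
    then show ?thesis by (intro negligible_mono[OF negligible_empty]) blast
  next
    case True
    then obtain z where z: "z \<in> A" "z \<otimes> a \<otimes> z = b" by blast
    have zG: "z \<in> carrier G" using z AG by simp
    have "\<not> finite_index (K a)" using a unfolding V_def by simp
    then have neg: "negligible (K a #> z)" by (rule negligible_coset[OF K[OF a(1)] _ zG])
    have "{x \<in> A. x \<otimes> a \<otimes> x = b} \<subseteq> K a #> z"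
    proof
      fix x assume "x \<in> {x \<in> A. x \<otimes> a \<otimes> x = b}"
      then have x: "x \<in> A" "x \<otimes> a \<otimes> x = b" by auto
      have xG: "x \<in> carrier G" using x AG by simp
      have zA: "inv z \<in> A" using subgroup.m_inv_closed[OF A(1) z(1)] .
      have "(x \<otimes> inv z) \<otimes> a \<otimes> (x \<otimes> inv z) = inv z \<otimes> (x \<otimes> a \<otimes> x) \<otimes> inv z"
        using comm[OF x(1) zA] xG zG a(1) by (simp add: m_assoc)
      also have "\<dots> = inv z \<otimes> (z \<otimes> a \<otimes> z) \<otimes> inv z" using x(2) z(2) by simp
      also have "\<dots> = a" using zG a(1) by (simp add: group_simps)
      finally have "x \<otimes> inv z \<in> K a"
        using subgroup.m_closed[OF A(1) x(1) zA] unfolding K_def by simp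
      moreover have "x = (x \<otimes> inv z) \<otimes> z" using xG zG by (simp add: group_simps)
      ultimately show "x \<in> K a #> z" unfolding r_coset_def by blast
    qed
    then show ?thesis by (rule negligible_mono[OF neg])
  qed
  have "\<exists>x. generic V F x" if F: "finite F" "F \<subseteq> carrier G" for F
  proof -
    obtain N Z where N: "negligible N" and Z: "subgroup Z G" "finite_index Z"
      and NF: "\<And>x. x \<in> Z \<Longrightarrow> x \<notin> N \<Longrightarrow> x \<notin> F"
      and conj: "\<And>x a b. x \<in> Z \<Longrightarrow> x \<notin> N \<Longrightarrow> a \<in> F \<Longrightarrow> b \<in> F \<Longrightarrow> x \<otimes> a \<otimes> inv x = b \<Longrightarrow> a = b"
      by (rule conj_generic[OF inf F], rule that, assumption+)
    \<comment> \<open>On \<open>L\<close> every label in \<open>F \<inter> V\<close> satisfies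
      \<open>x \<otimes> a \<otimes> x = a\<close>, which forces \<open>b = a\<close>; the other
      labels contribute only to the negligible set \<open>M\<close>.\<close>
    define L where "L = carrier G \<inter> (\<Inter>a\<in>F \<inter> V. K a)"
    define M where "M = N \<union> (\<Union>p\<in>(F - V) \<times> F. {x \<in> A. x \<otimes> fst p \<otimes> x = snd p})"
    have L: "finite_index L \<and> subgroup L G"
      unfolding L_def
    proof (rule finite_index_INT)
      show "finite (F \<inter> V)" using F(1) by simp
    qed (use K in \<open>auto simp: V_def\<close>)
    have M: "negligible M"
      unfolding M_def
    proof (intro negligible_Un negligible_UN N)
      show "finite ((F - V) \<times> F)" using F(1) by simp
      show "negligible {x \<in> A. x \<otimes> fst p \<otimes> x = snd p}" if "p \<in> (F - V) \<times> F" for p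
        using that F(2) by (intro quad) auto
    qed
    have "finite_index (L \<inter> (Z \<inter> A))"
      using L Z A by (intro finite_index_Int subgroups_Inter_pair) auto
    then have "\<not> L \<inter> (Z \<inter> A) \<subseteq> M" using negligible_mono[OF M] not_negligible_finite_index by auto
    then obtain x where x: "x \<in> L" "x \<in> Z" "x \<in> A" "x \<notin> M" by blast
    have xN: "x \<notin> N" using x(4) unfolding M_def by simp
    have "a = b \<and> a \<in> V" if a: "a \<in> F" "b \<in> F" "x \<otimes> a \<otimes> x = b" for a b
    proof (cases "a \<in> V")
      case True
      then have "x \<in> K a" using x(1) a(1) unfolding L_def by blast
      then show ?thesis using True a(3) unfolding K_def by simp
    next
      case False
      then have "(a, b) \<in> (F - V) \<times> F" using a by simp
      moreover have "x \<in> {x \<in> A. x \<otimes> fst (a, b) \<otimes> x = snd (a, b)}" using x(3) a(3) by simp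
      ultimately have "x \<in> M" unfolding M_def by (intro UnI2 UN_I)
      then show ?thesis using x(4) by simp
    qed
    then have "generic V F x"
      unfolding generic_def using NF[OF x(2) xN] conj[OF x(2) xN] AG[OF x(3)] by simp
    then show ?thesis by blast
  qed
  then show ?thesis using one inv sq by blast
qed

lemma ex_generic:
  assumes inf: "infinite (carrier G)"
    and fg: "finite S" "S \<subseteq> carrier G" "generate G S = carrier G"
  shows "\<exists>V. \<one> \<notin> V \<and> (\<forall>a\<in>V. inv a \<in> V \<and> a \<otimes> a \<notin> V) \<and>
           (\<forall>F. finite F \<and> F \<subseteq> carrier G \<longrightarrow> (\<exists>x. generic V F x))"
proof (cases "finite_index fc_center")
  case True
  then obtain A where A: "subgroup A G" "finite_index A" "\<forall>x\<in>A. \<forall>y\<in>A. x \<otimes> y = y \<otimes> x"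
    using fc_center_abelian_finite_index[OF fg] by blast
  show ?thesis using A(3) by (intro ex_generic_abelian_finite_index[OF inf fg A(1,2)]) simp
next
  case False
  then show ?thesis
    using ex_generic_fc_infinite_index[OF inf] by (intro exI[of _ "{}"]) simp
qed

subsection \<open>Triangle gadgets\<close>

text \<open>The common neighbours of \<open>\<one>\<close> and \<open>t\<close>. For
  \<open>t \<in> T\<close> this is the number of triangles on an edge labelled
  \<open>t\<close>.\<close>

definition triangles :: "'a set \<Rightarrow> 'a \<Rightarrow> nat" where
  "triangles T t = card {u \<in> T. inv u \<otimes> t \<in> T}"

text \<open>The path through \<open>\<one>\<close>, \<open>x\<close> and \<open>s\<close> has the
  labels \<open>x\<close> and \<open>inv x \<otimes> s\<close> and closes to a triangle with an edge
  labelled \<open>s\<close>. The other two elements are the inverses demanded by symmetry.\<close>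

definition gadget :: "'a \<Rightarrow> 'a \<Rightarrow> 'a set" where
  "gadget x s = {x, inv x, inv x \<otimes> s, inv s \<otimes> x}"

text \<open>This bounds the old labels \<open>t\<close> that acquire a triangle with two new sides.
  Each of the sixteen products determines \<open>t\<close> directly or is an equation in
  \<open>x\<close> controlled by genericity; \<open>x \<otimes> \<one> \<otimes> x = b\<close> has
  no solution since \<open>\<one> \<notin> V\<close>.\<close>

lemma gadget_product:
  assumes V: "\<one> \<notin> V" "\<And>a. a \<in> V \<Longrightarrow> inv a \<in> V"
    and x: "generic V F x"
    and T: "T \<subseteq> carrier G" "\<one> \<notin> T" "\<And>t. t \<in> T \<Longrightarrow> inv t \<in> T"
    and F: "\<one> \<in> F" "T \<subseteq> F" "\<And>a b. a \<in> T \<Longrightarrow> b \<in> T \<Longrightarrow> a \<otimes> b \<in> F"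
    and s: "s \<in> T" and t: "t \<in> T" "u \<in> gadget x s" "v \<in> gadget x s" "t = u \<otimes> v"
  shows "t = s \<or> t = inv s \<or> s \<in> V \<and> (t = s \<otimes> s \<or> t = inv s \<otimes> inv s)"
proof -
  have xG: "x \<in> carrier G" using x unfolding generic_def by simp
  have sG: "s \<in> carrier G" "t \<in> carrier G" using s t T by auto
  have Q: "a = b \<and> a \<in> V" if "a \<in> F" "b \<in> F" "x \<otimes> a \<otimes> x = b" for a b
    using x that unfolding generic_def by simp
  have C: "a = b" if "a \<in> F" "b \<in> F" "x \<otimes> a \<otimes> inv x = b" for a b
    using x that unfolding generic_def by simp
  have not1: "t \<noteq> \<one>" using t(1) T(2) by auto
  have no: False if "b \<in> F" "x \<otimes> \<one> \<otimes> x = b" for b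
    using Q[OF F(1) that] V(1) by simp
  have mem: "s \<in> F" "inv s \<in> F" "t \<in> F" "inv t \<in> F" "s \<otimes> t \<in> F" "s \<otimes> inv t \<in> F" "t \<otimes> inv s \<in> F"
    using s t(1) T(3) F(2,3) by (simp_all add: subset_iff)
  consider "u = x" "v = x" | "u = x" "v = inv x" | "u = x" "v = inv x \<otimes> s" | "u = x" "v = inv s \<otimes> x"
    | "u = inv x" "v = x" | "u = inv x" "v = inv x" | "u = inv x" "v = inv x \<otimes> s" | "u = inv x" "v = inv s \<otimes> x"
    | "u = inv x \<otimes> s" "v = x" | "u = inv x \<otimes> s" "v = inv x" | "u = inv x \<otimes> s" "v = inv x \<otimes> s"
    | "u = inv x \<otimes> s" "v = inv s \<otimes> x"
    | "u = inv s \<otimes> x" "v = x" | "u = inv s \<otimes> x" "v = inv x" | "u = inv s \<otimes> x" "v = inv x \<otimes> s"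
    | "u = inv s \<otimes> x" "v = inv s \<otimes> x"
    using t(2,3) unfolding gadget_def by (elim insertE emptyE) (rule that, assumption, assumption)+
  then show ?thesis
  proof cases
    case 1
    then show ?thesis using no[of t] mem t(4) xG by simp
  next
    case 2
    then show ?thesis using not1 t(4) xG by simp
  next
    case 3
    then show ?thesis using t(4) xG sG(1) by (simp add: group_simps)
  next
    case 4
    then have "x \<otimes> inv s \<otimes> x = t" using t(4) xG sG(1) by (simp add: group_simps)
    then show ?thesis using Q mem by metis
  next
    case 5
    then show ?thesis using not1 t(4) xG by simp
  next
    case 6
    then have "x \<otimes> \<one> \<otimes> x = inv t" using t(4) xG by (simp add: group_simps)
    then show ?thesis using no mem by metis
  next
    case 7
    then have "x \<otimes> \<one> \<otimes> x = s \<otimes> inv t" using t(4) xG sG(1) by (simp add: group_simps)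
    then show ?thesis using no mem by metis
  next
    case 8
    then have "x \<otimes> t \<otimes> inv x = inv s" using t(4) xG sG(1) by (simp add: group_simps)
    then show ?thesis using C mem by metis
  next
    case 9
    then have "x \<otimes> t \<otimes> inv x = s" using t(4) xG sG(1) by (simp add: group_simps)
    then show ?thesis using C mem by metis
  next
    case 10
    then have "x \<otimes> t \<otimes> x = s" using t(4) xG sG(1) by (simp add: group_simps)
    then show ?thesis using Q mem by metis
  next
    \<comment> \<open>Squares enter here and in case 16, through
      \<open>x \<otimes> s \<otimes> x = s\<close> or the same equation for
      \<open>inv s\<close>.\<close>
    case 11
    then have "x \<otimes> (t \<otimes> inv s) \<otimes> x = s" using t(4) xG sG(1) by (simp add: group_simps)
    then have *: "t \<otimes> inv s = s" "t \<otimes> inv s \<in> V" using Q mem by metis+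
    have "t = (t \<otimes> inv s) \<otimes> s" using sG by (simp add: group_simps)
    then have "t = s \<otimes> s" using *(1) by simp
    moreover have "s \<in> V" using * by simp
    ultimately show ?thesis by simp
  next
    case 12
    then show ?thesis using not1 t(4) xG sG(1) by (simp add: group_simps)
  next
    case 13
    then have "x \<otimes> \<one> \<otimes> x = s \<otimes> t" using t(4) xG sG(1) by (simp add: group_simps)
    then show ?thesis using no mem by metis
  next
    case 14
    then show ?thesis using t(4) xG sG(1) by (simp add: group_simps)
  next
    case 15
    then show ?thesis using not1 t(4) xG sG(1) by (simp add: group_simps)
  next
    case 16
    then have "x \<otimes> inv s \<otimes> x = s \<otimes> t" using t(4) xG sG(1) by (simp add: group_simps)
    then have *: "inv s = s \<otimes> t" "inv s \<in> V" using Q mem by metis+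
    have "t = inv s \<otimes> (s \<otimes> t)" using sG by (simp add: group_simps)
    then have "t = inv s \<otimes> inv s" using *(1) by simp
    moreover have "s \<in> V" using V(2)[OF *(2)] sG by simp
    ultimately show ?thesis by simp
  qed
qed

text \<open>Products of two old labels are never new, so no triangle has exactly one new side. New
  triangles on an old edge have both other sides in \<open>D\<close>; on a new edge one of the other
  two sides is in \<open>D\<close>, with at most \<open>card D\<close> choices in each
  position.\<close>

lemma triangles_disjoint_extension:
  assumes fin: "finite T" "finite D" and T: "T \<subseteq> carrier G" "\<And>t. t \<in> T \<Longrightarrow> inv t \<in> T"
    and D: "D \<subseteq> carrier G" "D \<inter> T = {}" "\<And>a b. a \<in> T \<Longrightarrow> b \<in> T \<Longrightarrow> a \<otimes> b \<notin> D"
  shows "t \<in> T \<Longrightarrow> triangles (T \<union> D) t = triangles T t + triangles D t"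
    and "t \<in> D \<Longrightarrow> triangles (T \<union> D) t \<le> 2 * card D"
proof -
  assume t: "t \<in> T"
  have tG: "t \<in> carrier G" using t T(1) by blast
  have "inv u \<otimes> t \<notin> D" if "u \<in> T" for u using D(3) T(2) that t by simp
  moreover have "inv u \<otimes> t \<notin> T" if u: "u \<in> D" for u
  proof
    assume v: "inv u \<otimes> t \<in> T"
    have "u \<in> carrier G" using u D(1) by blast
    then have "u = t \<otimes> inv (inv u \<otimes> t)" using tG by (simp add: group_simps)
    then show False using D(3)[OF t T(2)[OF v]] u by simp
  qed
  ultimately have eq: "{u \<in> T \<union> D. inv u \<otimes> t \<in> T \<union> D} =
      {u \<in> T. inv u \<otimes> t \<in> T} \<union> {u \<in> D. inv u \<otimes> t \<in> D}" by blast
  show "triangles (T \<union> D) t = triangles T t + triangles D t"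
    unfolding triangles_def eq using fin D(2) by (intro card_Un_disjoint) auto
next
  assume t: "t \<in> D"
  have tG: "t \<in> carrier G" using t D(1) by blast
  have "{u \<in> T \<union> D. inv u \<otimes> t \<in> T \<union> D} \<subseteq> D \<union> (\<lambda>v. t \<otimes> inv v) ` D"
  proof
    fix u assume u: "u \<in> {u \<in> T \<union> D. inv u \<otimes> t \<in> T \<union> D}"
    then have uG: "u \<in> carrier G" using T(1) D(1) by blast
    have e: "u \<otimes> (inv u \<otimes> t) = t" "t \<otimes> inv (inv u \<otimes> t) = u" using uG tG by (simp_all add: group_simps)
    show "u \<in> D \<union> (\<lambda>v. t \<otimes> inv v) ` D"
    proof (cases "u \<in> D")
      case False
      then have "inv u \<otimes> t \<in> D" using D(3)[of u "inv u \<otimes> t"] u t e(1) by auto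
      then show ?thesis using e(2) by (intro UnI2 image_eqI[of _ _ "inv u \<otimes> t"]) simp_all
    qed simp
  qed
  then have "triangles (T \<union> D) t \<le> card (D \<union> (\<lambda>v. t \<otimes> inv v) ` D)"
    unfolding triangles_def using fin by (intro card_mono) auto
  also have "\<dots> \<le> card D + card ((\<lambda>v. t \<otimes> inv v) ` D)" by (rule card_Un_le)
  also have "\<dots> \<le> 2 * card D" using card_image_le[OF fin(2), of "\<lambda>v. t \<otimes> inv v"] by simp
  finally show "triangles (T \<union> D) t \<le> 2 * card D" .
qed

section \<open>Telling labels apart by triangle counts\<close>

definition admissible :: "'a set \<Rightarrow> bool" where
  "admissible V \<longleftrightarrow> \<one> \<notin> V \<and> (\<forall>a\<in>V. inv a \<in> V \<and> a \<otimes> a \<notin> V) \<and>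
     (\<forall>F. finite F \<and> F \<subseteq> carrier G \<longrightarrow> (\<exists>x. generic V F x))"

text \<open>\<open>S\<close> holds the labels to be recognised, \<open>T - S\<close> the auxiliary
  ones. The condition on products keeps squares of labels in \<open>S\<close> from being auxiliary,
  so that later gadgets do not raise the count of an auxiliary label.\<close>

definition sparse_extension :: "'a set \<Rightarrow> 'a set \<Rightarrow> bool" where
  "sparse_extension S T \<longleftrightarrow> finite T \<and> S \<subseteq> T \<and> T \<subseteq> carrier G \<and> \<one> \<notin> T \<and> (\<forall>t\<in>T. inv t \<in> T) \<and>
     (\<forall>a\<in>S. \<forall>b\<in>S. a \<otimes> b \<in> T \<longrightarrow> a \<otimes> b \<in> S) \<and> (\<forall>t\<in>T - S. triangles T t \<le> 8)"

text \<open>The gadget for \<open>s\<close> puts triangles on \<open>s\<^sup>2\<close> when conjugation by \<open>s\<close> inverts \<open>x\<close>, that is, for \<open>s \<in> V\<close>.\<close>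
lemma sparse_extension_gadget:
  assumes V: "admissible V" and T: "sparse_extension S T" and s: "s \<in> S" "\<And>a. a \<in> S \<Longrightarrow> inv a \<in> S"
  shows "\<exists>T'. sparse_extension S T' \<and> triangles T s < triangles T' s \<and>
     triangles T (inv s) < triangles T' (inv s) \<and>
     (\<forall>t\<in>S. t \<noteq> s \<and> t \<noteq> inv s \<and> (s \<in> V \<longrightarrow> t \<noteq> s \<otimes> s \<and> t \<noteq> inv s \<otimes> inv s) \<longrightarrow>
        triangles T' t = triangles T t)"
proof -
  have T': "finite T" "S \<subseteq> T" "T \<subseteq> carrier G" "\<one> \<notin> T" "\<And>t. t \<in> T \<Longrightarrow> inv t \<in> T"
    "\<And>a b. a \<in> S \<Longrightarrow> b \<in> S \<Longrightarrow> a \<otimes> b \<in> T \<Longrightarrow> a \<otimes> b \<in> S" "\<And>t. t \<in> T - S \<Longrightarrow> triangles T t \<le> 8"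
    using T unfolding sparse_extension_def by auto
  define E where "E = insert \<one> T"
  \<comment> \<open>Triple products, because \<open>a \<otimes> b = inv s \<otimes> x\<close> and
    \<open>a \<otimes> b = inv x \<otimes> s\<close> both write \<open>x\<close> as a product of
    three elements of \<open>E\<close>.\<close>
  define F where "F = (\<lambda>(a, b, c). a \<otimes> b \<otimes> c) ` (E \<times> E \<times> E)"
  have E: "finite E" "E \<subseteq> carrier G" "\<one> \<in> E" "T \<subseteq> E" "\<And>t. t \<in> E \<Longrightarrow> inv t \<in> E"
    using T' unfolding E_def by auto
  have EG: "a \<in> carrier G" if "a \<in> E" for a using E(2) that by blast
  have F3: "a \<otimes> b \<otimes> c \<in> F" if "a \<in> E" "b \<in> E" "c \<in> E" for a b c
    unfolding F_def using that by (intro image_eqI[of _ _ "(a, b, c)"]) auto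
  have F2: "a \<otimes> b \<in> F" if "a \<in> E" "b \<in> E" for a b
    using F3[OF that E(3)] EG that by simp
  have F1: "a \<in> F" if "a \<in> E" for a using F2[OF that E(3)] EG that by simp
  have "finite F" "F \<subseteq> carrier G" unfolding F_def using E(1) EG by auto
  then obtain x where x: "generic V F x" using V unfolding admissible_def by blast
  have xG: "x \<in> carrier G" and xF: "x \<notin> F" using x unfolding generic_def by auto
  have sT: "s \<in> T" "inv s \<in> T" using s T' by auto
  have sE: "s \<in> E" "inv s \<in> E" and sG: "s \<in> carrier G" using sT E(4) T'(3) by auto
  define D where "D = gadget x s"
  have D: "finite D" "D \<subseteq> carrier G" "card D \<le> 4"
    unfolding D_def gadget_def using xG sG by (auto simp: card_insert_if)
  have notD: "a \<otimes> b \<notin> D" if ab: "a \<in> E" "b \<in> E" for a b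
  proof
    have G: "a \<in> carrier G" "b \<in> carrier G" using ab EG by auto
    assume "a \<otimes> b \<in> D"
    then consider "a \<otimes> b = x" | "a \<otimes> b = inv x" | "a \<otimes> b = inv x \<otimes> s" | "a \<otimes> b = inv s \<otimes> x"
      unfolding D_def gadget_def by blast
    then show False
    proof cases
      case 1
      then show ?thesis using F2[OF ab] xF by simp
    next
      case 2
      then have "inv (a \<otimes> b) = x" using xG by simp
      then have "x = inv b \<otimes> inv a" using G by (simp add: inv_mult_group)
      then show ?thesis using F2[of "inv b" "inv a"] E(5) ab xF by simp
    next
      case 3
      then have "s \<otimes> inv (a \<otimes> b) = x" using xG sG by (simp add: group_simps)
      then have "x = s \<otimes> inv b \<otimes> inv a" using G sG by (simp add: group_simps)
      then show ?thesis using F3[of s "inv b" "inv a"] E(5) ab sE xF by simp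
    next
      case 4
      then have "s \<otimes> (a \<otimes> b) = x" using xG sG by (simp add: group_simps)
      then have "x = s \<otimes> a \<otimes> b" using G sG by (simp add: group_simps)
      then show ?thesis using F3[of s a b] ab sE xF by simp
    qed
  qed
  have TD: "a \<otimes> b \<notin> D" if "a \<in> T" "b \<in> T" for a b using notD that E(4) by blast
  have "a \<notin> D" if "a \<in> E" for a using notD[OF that E(3)] EG[OF that] by simp
  then have ED: "D \<inter> T = {}" "\<one> \<notin> D" using E(3,4) by auto
  have ext: "triangles (T \<union> D) t = triangles T t + triangles D t" if "t \<in> T" for t
    using T'(5) D(2) ED(1) TD that by (intro triangles_disjoint_extension(1)[OF T'(1) D(1) T'(3)])
  have ext_new: "triangles (T \<union> D) t \<le> 8" if "t \<in> D" for t
  proof -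
    have "triangles (T \<union> D) t \<le> 2 * card D"
      using T'(5) D(2) ED(1) TD that by (intro triangles_disjoint_extension(2)[OF T'(1) D(1) T'(3)])
    then show ?thesis using D(3) by simp
  qed
  have tri_D: "triangles D t = 0"
    if t: "t \<in> T" "t \<noteq> s" "t \<noteq> inv s" "s \<in> V \<Longrightarrow> t \<noteq> s \<otimes> s \<and> t \<noteq> inv s \<otimes> inv s" for t
  proof -
    have "inv u \<otimes> t \<notin> D" if u: "u \<in> D" for u
    proof
      assume v: "inv u \<otimes> t \<in> D"
      have "u \<in> carrier G" "t \<in> carrier G" using u D t T' by auto
      then have eq: "t = u \<otimes> (inv u \<otimes> t)" by (simp add: group_simps)
      have "t = s \<or> t = inv s \<or> s \<in> V \<and> (t = s \<otimes> s \<or> t = inv s \<otimes> inv s)"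
      proof (rule gadget_product[OF _ _ x T'(3,4)])
        show "\<one> \<notin> V" "\<And>a. a \<in> V \<Longrightarrow> inv a \<in> V" using V unfolding admissible_def by auto
        show "T \<subseteq> F" "\<one> \<in> F" using F1 E(3,4) by auto
        show "a \<otimes> b \<in> F" if "a \<in> T" "b \<in> T" for a b using F2 E(4) that by blast
      qed (use T'(5) sT t u v eq D_def in simp_all)
      then show False using t by blast
    qed
    then have none: "{u \<in> D. inv u \<otimes> t \<in> D} = {}" by blast
    show ?thesis unfolding triangles_def none by simp
  qed
  have "x \<in> {u \<in> D. inv u \<otimes> s \<in> D}" unfolding D_def gadget_def by simp
  then have pos: "triangles D s > 0" unfolding triangles_def using D(1) by (auto simp: card_gt_0_iff)
  have "inv s \<otimes> x \<in> {u \<in> D. inv u \<otimes> inv s \<in> D}"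
    unfolding D_def gadget_def using xG sG by (simp add: group_simps)
  then have pos': "triangles D (inv s) > 0" unfolding triangles_def using D(1) by (auto simp: card_gt_0_iff)
  have "sparse_extension S (T \<union> D)"
    unfolding sparse_extension_def
  proof (intro conjI ballI impI)
    show "inv t \<in> T \<union> D" if "t \<in> T \<union> D" for t
    proof (cases "t \<in> T")
      case False
      then have "t \<in> gadget x s" using that D_def by simp
      then have "inv t \<in> gadget x s"
        unfolding gadget_def using xG sG by (auto simp: group_simps)
      then show ?thesis using D_def by simp
    qed (use T'(5) in simp)
    show "a \<otimes> b \<in> S" if "a \<in> S" "b \<in> S" "a \<otimes> b \<in> T \<union> D" for a b
    proof -
      have "a \<in> T" "b \<in> T" using that T'(2) by auto
      then show ?thesis using TD T'(6) that by blast
    qed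
    show "triangles (T \<union> D) t \<le> 8" if t: "t \<in> T \<union> D - S" for t
    proof (cases "t \<in> T")
      case True
      have "t \<noteq> s" "t \<noteq> inv s" using t s by auto
      \<comment> \<open>A square of \<open>s\<close> or \<open>inv s\<close> that lies in
        \<open>T\<close> belongs to \<open>S\<close>, so the side effect of the gadget misses the
        auxiliary labels.\<close>
      moreover have "t \<noteq> s \<otimes> s" "t \<noteq> inv s \<otimes> inv s" using T'(6) True t s by auto
      ultimately have "triangles D t = 0" using tri_D True by blast
      then show ?thesis using ext[OF True] T'(7) True t by simp
    next
      case False
      then show ?thesis using ext_new t by simp
    qed
  qed (use T' D ED in auto)
  moreover have "triangles T s < triangles (T \<union> D) s" using ext[of s] sT pos by simp
  moreover have "triangles T (inv s) < triangles (T \<union> D) (inv s)" using ext[of "inv s"] sT pos' by simp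
  moreover have "triangles (T \<union> D) t = triangles T t"
    if "t \<in> S" "t \<noteq> s \<and> t \<noteq> inv s \<and> (s \<in> V \<longrightarrow> t \<noteq> s \<otimes> s \<and> t \<noteq> inv s \<otimes> inv s)" for t
  proof -
    have "t \<in> T" using that T'(2) by blast
    then show ?thesis using ext[of t] tri_D[of t] that by simp
  qed
  ultimately show ?thesis by (intro exI[of _ "T \<union> D"]) simp
qed

lemma sparse_extension_many_triangles:
  assumes V: "admissible V" and T: "sparse_extension S T" and s: "s \<in> S" "\<And>a. a \<in> S \<Longrightarrow> inv a \<in> S"
  shows "\<exists>T'. sparse_extension S T' \<and> m \<le> triangles T' s \<and> m \<le> triangles T' (inv s) \<and>
     (\<forall>t\<in>S. t \<noteq> s \<and> t \<noteq> inv s \<and> (s \<in> V \<longrightarrow> t \<noteq> s \<otimes> s \<and> t \<noteq> inv s \<otimes> inv s) \<longrightarrow>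
        triangles T' t = triangles T t)"
proof (induction m)
  case 0
  show ?case using T by (intro exI[of _ T]) simp
next
  case (Suc m)
  then obtain T1 where T1: "sparse_extension S T1" "m \<le> triangles T1 s" "m \<le> triangles T1 (inv s)"
    "\<forall>t\<in>S. t \<noteq> s \<and> t \<noteq> inv s \<and> (s \<in> V \<longrightarrow> t \<noteq> s \<otimes> s \<and> t \<noteq> inv s \<otimes> inv s) \<longrightarrow>
        triangles T1 t = triangles T t" by blast
  obtain T2 where T2: "sparse_extension S T2" "triangles T1 s < triangles T2 s"
    "triangles T1 (inv s) < triangles T2 (inv s)"
    "\<forall>t\<in>S. t \<noteq> s \<and> t \<noteq> inv s \<and> (s \<in> V \<longrightarrow> t \<noteq> s \<otimes> s \<and> t \<noteq> inv s \<otimes> inv s) \<longrightarrow>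
        triangles T2 t = triangles T1 t"
    using sparse_extension_gadget[OF V T1(1) s] by blast
  show ?case using T1 T2 by (intro exI[of _ T2]) simp
qed

text \<open>Counts above 8 set \<open>U\<close> apart from auxiliary labels. A label and its inverse
  belong to the same unoriented edge, so they are not asked to differ.\<close>

definition separated :: "'a set \<Rightarrow> 'a set \<Rightarrow> bool" where
  "separated U T \<longleftrightarrow> (\<forall>u\<in>U. 8 < triangles T u \<and>
     (\<forall>t\<in>U. triangles T t = triangles T u \<longrightarrow> t = u \<or> t = inv u))"

text \<open>The count of \<open>s\<close> is raised above every count present. If
  \<open>s \<in> V\<close>, the squares of \<open>s\<close> and \<open>inv s\<close> may be affected
  as well, but they lie outside \<open>V\<close> and therefore outside \<open>U\<close>.\<close>

lemma separated_insert:
  assumes V: "admissible V" and T: "sparse_extension S T" and s: "s \<in> S" "\<And>a. a \<in> S \<Longrightarrow> inv a \<in> S"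
    and U: "U \<subseteq> S" "\<And>u. u \<in> U \<Longrightarrow> inv u \<in> U" "separated U T" "s \<in> V \<Longrightarrow> U \<subseteq> V"
  shows "\<exists>T'. sparse_extension S T' \<and> separated (insert s (insert (inv s) U)) T'"
proof (cases "s \<in> U")
  case True
  then have "insert s (insert (inv s) U) = U" using U(2) by blast
  then show ?thesis using T U(3) by auto
next
  case False
  have finS: "finite S" and SG: "S \<subseteq> carrier G"
    using T unfolding sparse_extension_def by (auto intro: finite_subset)
  have sG: "s \<in> carrier G" using s SG by blast
  \<comment> \<open>The sum dominates each single count on \<open>S\<close>; the summand 9 makes
    \<open>m\<close> exceed both these counts and 8.\<close>
  define m where "m = 9 + (\<Sum>t\<in>S. triangles T t)"
  obtain T' where T': "sparse_extension S T'" "m \<le> triangles T' s" "m \<le> triangles T' (inv s)"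
    "\<And>t. t \<in> S \<Longrightarrow> t \<noteq> s \<and> t \<noteq> inv s \<and> (s \<in> V \<longrightarrow> t \<noteq> s \<otimes> s \<and> t \<noteq> inv s \<otimes> inv s) \<Longrightarrow>
        triangles T' t = triangles T t"
    using sparse_extension_many_triangles[OF V T s, of m] by blast
  have old: "triangles T' u = triangles T u" "triangles T u < m" if u: "u \<in> U" for u
  proof -
    have uS: "u \<in> S" using u U(1) by blast
    have "u \<noteq> inv s"
    proof
      assume "u = inv s"
      then have "s \<in> U" using U(2)[OF u] sG by simp
      then show False using False by simp
    qed
    moreover have "u \<noteq> s \<otimes> s \<and> u \<noteq> inv s \<otimes> inv s" if "s \<in> V"
    proof -
      have "u \<in> V" using U(4)[OF that] u by blast
      moreover have "s \<otimes> s \<notin> V" "inv s \<otimes> inv s \<notin> V" using V that unfolding admissible_def by auto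
      ultimately show ?thesis by blast
    qed
    moreover have "u \<noteq> s" using False u by blast
    ultimately show "triangles T' u = triangles T u" using T'(4)[OF uS] by blast
    show "triangles T u < m"
      using member_le_sum[of u S "triangles T"] uS finS unfolding m_def by simp
  qed
  have "8 < m" unfolding m_def by simp
  have "separated (insert s (insert (inv s) U)) T'"
    unfolding separated_def
  proof (intro ballI conjI impI)
    fix u assume u: "u \<in> insert s (insert (inv s) U)"
    show "8 < triangles T' u"
      using u T'(2,3) \<open>8 < m\<close> U(3) old(1) unfolding separated_def by auto
    fix t assume t: "t \<in> insert s (insert (inv s) U)" and eq: "triangles T' t = triangles T' u"
    consider "u \<in> U" "t \<in> U" | "u \<in> U" "t = s \<or> t = inv s" | "u = s \<or> u = inv s" "t \<in> U"
      | "u = s \<or> u = inv s" "t = s \<or> t = inv s" using u t by blast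
    then show "t = u \<or> t = inv u"
    proof cases
      case 1
      then show ?thesis using U(3) old(1) eq unfolding separated_def by simp
    next
      case 2
      then show ?thesis using old[of u] T'(2,3) eq by auto
    next
      case 3
      then show ?thesis using old[of t] T'(2,3) eq by auto
    next
      case 4
      then show ?thesis using sG by auto
    qed
  qed
  then show ?thesis using T'(1) by blast
qed

text \<open>Labels are inserted one by one. The last assumption guarantees that a label of
  \<open>V\<close> is inserted only while everything treated so far lies in
  \<open>V\<close>.\<close>

lemma separated_Un:
  assumes V: "admissible V" and S: "\<And>a. a \<in> S \<Longrightarrow> inv a \<in> S"
    and U: "U \<subseteq> S" "\<And>u. u \<in> U \<Longrightarrow> inv u \<in> U" "\<exists>T. sparse_extension S T \<and> separated U T"
    and W: "finite W" "W \<subseteq> S" "\<And>s. s \<in> W \<Longrightarrow> s \<in> V \<Longrightarrow> U \<union> W \<subseteq> V"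
  shows "\<exists>T. sparse_extension S T \<and> separated (U \<union> W \<union> m_inv G ` W) T"
  using W
proof (induction W rule: finite_induct)
  case empty
  then show ?case using U(3) by simp
next
  case (insert s W)
  let ?U = "U \<union> W \<union> m_inv G ` W"
  have "U \<union> W \<subseteq> V" if "w \<in> W" "w \<in> V" for w using insert.prems(2)[of w] that by blast
  then obtain T where T: "sparse_extension S T" "separated ?U T"
    using insert.IH insert.prems(1) by auto
  have WG: "W \<subseteq> carrier G" using insert.prems(1) T(1) unfolding sparse_extension_def by blast
  have "\<exists>T'. sparse_extension S T' \<and> separated (insert s (insert (inv s) ?U)) T'"
  proof (rule separated_insert[OF V T(1) _ S _ _ T(2)])
    show "inv u \<in> ?U" if "u \<in> ?U" for u using that U(2) WG by auto
    show "?U \<subseteq> V" if "s \<in> V"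
    proof -
      have "U \<union> W \<subseteq> V" using insert.prems(2)[of s] that by blast
      moreover have "inv a \<in> V" if "a \<in> V" for a using V that unfolding admissible_def by blast
      ultimately show ?thesis by blast
    qed
  qed (use insert.prems(1) U(1) S in auto)
  moreover have "insert s (insert (inv s) ?U) = U \<union> insert s W \<union> m_inv G ` insert s W" by auto
  ultimately show ?case by simp
qed

text \<open>The labels in \<open>V\<close> are processed first: their squares lie outside \<open>V\<close>, so no later step changes
  the triangle counts on \<open>V\<close>.\<close>
lemma ex_separated:
  assumes V: "admissible V" and S: "finite S" "S \<subseteq> carrier G" "\<one> \<notin> S" "\<And>a. a \<in> S \<Longrightarrow> inv a \<in> S"
  shows "\<exists>T. sparse_extension S T \<and> separated S T"
proof -
  have Vinv: "inv a \<in> V" if "a \<in> V" for a using V that unfolding admissible_def by blast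
  have img: "m_inv G ` (S \<inter> V) \<subseteq> S \<inter> V" using S(4) Vinv by blast
  have "sparse_extension S S" unfolding sparse_extension_def using S by simp
  then have "\<exists>T. sparse_extension S T \<and> separated {} T" unfolding separated_def by auto
  then have "\<exists>T. sparse_extension S T \<and> separated ({} \<union> (S \<inter> V) \<union> m_inv G ` (S \<inter> V)) T"
    using S(1) by (intro separated_Un[OF V S(4)]) auto
  then have 1: "\<exists>T. sparse_extension S T \<and> separated (S \<inter> V) T"
    using img by (simp add: Un_absorb2)
  have "\<exists>T. sparse_extension S T \<and> separated ((S \<inter> V) \<union> (S - V) \<union> m_inv G ` (S - V)) T"
    using S(1) by (intro separated_Un[OF V S(4) _ _ 1]) (use S(4) Vinv in auto)
  moreover have "(S \<inter> V) \<union> (S - V) \<union> m_inv G ` (S - V) = S" using S(4) by blast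
  ultimately show ?thesis by simp
qed

subsection \<open>Automorphisms of the Cayley graph\<close>

lemma m_inv_image_eq:
  assumes "T \<subseteq> carrier G" "\<And>t. t \<in> T \<Longrightarrow> inv t \<in> T"
  shows "m_inv G ` T = T"
proof
  show "m_inv G ` T \<subseteq> T" using assms(2) by blast
  show "T \<subseteq> m_inv G ` T"
  proof
    fix t assume t: "t \<in> T"
    then have "t = inv (inv t)" using assms(1) by (simp add: subset_iff)
    then show "t \<in> m_inv G ` T" using assms(2)[OF t] by (rule image_eqI)
  qed
qed

lemma countable_carrier:
  assumes "countable S" "S \<subseteq> carrier G" "\<And>s. s \<in> S \<Longrightarrow> inv s \<in> S" "generate G S = carrier G"
  shows "countable (carrier G)"
proof -
  have "\<exists>l\<in>lists S. g = foldl (\<otimes>) \<one> l" if "g \<in> generate G S" for g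
    using assms(2) that
  proof (induction rule: generate_right_induct)
    case one
    show ?case by (intro bexI[of _ "[]"]) auto
  next
    case (mult g s)
    then obtain l where "l \<in> lists S" "g = foldl (\<otimes>) \<one> l" by blast
    then show ?case using mult(2) by (intro bexI[of _ "l @ [s]"]) auto
  next
    case (inv g s)
    then obtain l where "l \<in> lists S" "g = foldl (\<otimes>) \<one> l" by blast
    then show ?case using assms(3)[OF inv(2)] by (intro bexI[of _ "l @ [inv s]"]) auto
  qed
  then have "carrier G \<subseteq> foldl (\<otimes>) \<one> ` lists S" using assms(4) by blast
  moreover have "countable (foldl (\<otimes>) \<one> ` lists S)" using assms(1) by blast
  ultimately show ?thesis using countable_subset by blast
qed

text \<open>Left translation by \<open>x\<close> moves the common neighbours of
  \<open>\<one>\<close> and \<open>inv x \<otimes> y\<close> to those of \<open>x\<close> and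
  \<open>y\<close>.\<close>

lemma card_common_neighbours:
  assumes T: "T \<subseteq> carrier G" and xy: "x \<in> carrier G" "y \<in> carrier G"
  shows "card {z \<in> carrier G. inv x \<otimes> z \<in> T \<and> inv z \<otimes> y \<in> T} = triangles T (inv x \<otimes> y)"
proof -
  have "bij_betw (\<lambda>u. x \<otimes> u) {u \<in> T. inv u \<otimes> (inv x \<otimes> y) \<in> T}
      {z \<in> carrier G. inv x \<otimes> z \<in> T \<and> inv z \<otimes> y \<in> T}"
  proof (rule bij_betw_byWitness[where f' = "\<lambda>z. inv x \<otimes> z"])
    show "\<forall>u\<in>{u \<in> T. inv u \<otimes> (inv x \<otimes> y) \<in> T}. inv x \<otimes> (x \<otimes> u) = u"
      using T xy by (auto simp: group_simps)
    show "\<forall>z\<in>{z \<in> carrier G. inv x \<otimes> z \<in> T \<and> inv z \<otimes> y \<in> T}. x \<otimes> (inv x \<otimes> z) = z"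
      using xy by (auto simp: group_simps)
    show "(\<lambda>u. x \<otimes> u) ` {u \<in> T. inv u \<otimes> (inv x \<otimes> y) \<in> T} \<subseteq>
        {z \<in> carrier G. inv x \<otimes> z \<in> T \<and> inv z \<otimes> y \<in> T}"
    proof (intro image_subsetI)
      fix u assume u: "u \<in> {u \<in> T. inv u \<otimes> (inv x \<otimes> y) \<in> T}"
      then have "u \<in> carrier G" using T by blast
      then show "x \<otimes> u \<in> {z \<in> carrier G. inv x \<otimes> z \<in> T \<and> inv z \<otimes> y \<in> T}"
        using u xy by (simp add: group_simps)
    qed
    show "(\<lambda>z. inv x \<otimes> z) ` {z \<in> carrier G. inv x \<otimes> z \<in> T \<and> inv z \<otimes> y \<in> T} \<subseteq>
        {u \<in> T. inv u \<otimes> (inv x \<otimes> y) \<in> T}"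
      using xy by (auto simp: group_simps)
  qed
  then show ?thesis unfolding triangles_def by (rule bij_betw_same_card[symmetric])
qed

lemma graph_auto_triangles:
  assumes T: "T \<subseteq> carrier G" "m_inv G ` T = T" and f: "f \<in> graph_auto (cayley_graph G T)"
    and xy: "x \<in> carrier G" "y \<in> carrier G"
  shows "f x \<in> carrier G" "inv (f x) \<otimes> f y \<in> T \<longleftrightarrow> inv x \<otimes> y \<in> T"
    "triangles T (inv (f x) \<otimes> f y) = triangles T (inv x \<otimes> y)"
proof -
  have V: "vertices (cayley_graph G T) = carrier G" by (simp add: cayley_graph_def)
  have bij: "bij_betw f (carrier G) (carrier G)" using f V by (simp add: graph_auto_def Bij_def)
  have fG: "f z \<in> carrier G" if "z \<in> carrier G" for z using bij that by (rule bij_betwE[rule_format])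
  show "f x \<in> carrier G" using fG xy by simp
  have edge: "inv (f x) \<otimes> f y \<in> T \<longleftrightarrow> inv x \<otimes> y \<in> T" if "x \<in> carrier G" "y \<in> carrier G" for x y
  proof -
    have "{f x, f y} \<in> edges (cayley_graph G T) \<longleftrightarrow> {x, y} \<in> edges (cayley_graph G T)"
      using f that V unfolding graph_auto_def by simp
    then show ?thesis using cayley_graph_edge_iff[OF T] that fG by simp
  qed
  show "inv (f x) \<otimes> f y \<in> T \<longleftrightarrow> inv x \<otimes> y \<in> T" using edge xy by simp
  let ?C = "\<lambda>x y. {z \<in> carrier G. inv x \<otimes> z \<in> T \<and> inv z \<otimes> y \<in> T}"
  have image: "f ` ?C x y = ?C (f x) (f y)"
  proof
    show "f ` ?C x y \<subseteq> ?C (f x) (f y)" using edge xy fG by auto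
    show "?C (f x) (f y) \<subseteq> f ` ?C x y"
    proof
      fix z assume z: "z \<in> ?C (f x) (f y)"
      then obtain w where w: "w \<in> carrier G" "z = f w"
        using bij by (auto simp: bij_betw_def)
      then have "w \<in> ?C x y" using z edge[OF xy(1) w(1)] edge[OF w(1) xy(2)] by simp
      then show "z \<in> f ` ?C x y" using w(2) by blast
    qed
  qed
  have "inj_on f (?C x y)" by (rule inj_on_subset[OF bij_betw_imp_inj_on[OF bij]]) blast
  then have "card (?C (f x) (f y)) = card (?C x y)" unfolding image[symmetric] by (rule card_image)
  then show "triangles T (inv (f x) \<otimes> f y) = triangles T (inv x \<otimes> y)"
    using card_common_neighbours[OF T(1)] xy fG by simp
qed

text \<open>The image edge lies in as many triangles as an edge labelled \<open>s\<close>, hence in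
  more than 8. So its label is not auxiliary, and separation leaves \<open>s\<close> and
  \<open>inv s\<close>.\<close>

lemma graph_auto_separated:
  assumes T: "sparse_extension S T" "separated S T" and f: "f \<in> graph_auto (cayley_graph G T)"
    and g: "g \<in> carrier G" and s: "s \<in> S"
  shows "f (g \<otimes> s) = f g \<otimes> s \<or> f (g \<otimes> s) = f g \<otimes> inv s"
proof -
  have T': "S \<subseteq> T" "T \<subseteq> carrier G" "\<And>t. t \<in> T \<Longrightarrow> inv t \<in> T" "\<And>t. t \<in> T - S \<Longrightarrow> triangles T t \<le> 8"
    using T(1) unfolding sparse_extension_def by auto
  have Tinv: "m_inv G ` T = T" using m_inv_image_eq T'(2,3) by simp
  have sG: "s \<in> carrier G" "s \<in> T" using s T' by auto
  have gsG: "g \<otimes> s \<in> carrier G" using g sG by simp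
  have e: "inv g \<otimes> (g \<otimes> s) = s" using g sG by (simp add: group_simps)
  note tri = graph_auto_triangles[OF T'(2) Tinv f g gsG, unfolded e]
  define r where "r = inv (f g) \<otimes> f (g \<otimes> s)"
  have fG: "f g \<in> carrier G" "f (g \<otimes> s) \<in> carrier G"
    using tri(1) graph_auto_triangles(1)[OF T'(2) Tinv f gsG gsG] by simp_all
  have r: "r \<in> T" "triangles T r = triangles T s" using tri(2,3) sG unfolding r_def by simp_all
  have "8 < triangles T s" using T(2) s unfolding separated_def by simp
  then have "r \<in> S" using T'(4)[of r] r by auto
  then have "r = s \<or> r = inv s" using T(2) s r(2) unfolding separated_def by simp
  moreover have "f (g \<otimes> s) = f g \<otimes> r" unfolding r_def using fG by (simp add: group_simps)
  ultimately show ?thesis by auto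
qed

text \<open>An exceptional value \<open>g c\<close> at \<open>g p t\<close> would force \<open>u c u = c\<close> for all words \<open>u\<close> of length two,
  so \<open>c\<close> inverts the generators and all their pairwise products. Hence the generators commute,
  \<open>t\<close> is an involution, and \<open>g c = g p t\<close> after all.\<close>
lemma fixed_ball_propagates:
  assumes S: "S \<subseteq> carrier G" "\<one> \<in> S" "\<And>s. s \<in> S \<Longrightarrow> inv s \<in> S"
    and B: "B = (\<lambda>(a, b). a \<otimes> b) ` (S \<times> S)"
    and col: "\<And>g u p t. g \<in> carrier G \<Longrightarrow> u \<in> B \<Longrightarrow> p \<in> B \<Longrightarrow> t \<in> S \<Longrightarrow>
        f (g \<otimes> (inv u \<otimes> p \<otimes> t)) \<in> {f g \<otimes> (inv u \<otimes> p \<otimes> t), f g \<otimes> inv (inv u \<otimes> p \<otimes> t)}"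
    and g: "g \<in> carrier G" and fix_B: "\<And>u. u \<in> B \<Longrightarrow> f (g \<otimes> u) = g \<otimes> u"
    and p: "p \<in> B" and t: "t \<in> S"
  shows "f (g \<otimes> p \<otimes> t) = g \<otimes> p \<otimes> t"
proof (rule ccontr)
  assume neq: "f (g \<otimes> p \<otimes> t) \<noteq> g \<otimes> p \<otimes> t"
  have SB: "a \<otimes> b \<in> B" if "a \<in> S" "b \<in> S" for a b
    unfolding B using that by (intro image_eqI[of _ _ "(a, b)"]) auto
  have S1: "a \<in> B" if "a \<in> S" for a using SB[OF that S(2)] that S(1) by (simp add: subset_iff)
  have SG: "a \<in> carrier G" if "a \<in> S" for a using that S(1) by blast
  have BG: "u \<in> carrier G" if "u \<in> B" for u using that SG unfolding B by auto
  have G: "p \<in> carrier G" "t \<in> carrier G" using p t BG SG by auto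
  \<comment> \<open>The vertex \<open>g \<otimes> p \<otimes> t\<close> is reached from every fixed
    vertex \<open>g \<otimes> u\<close> by the label \<open>inv u \<otimes> p \<otimes> t\<close>.
    If it moves, it must follow the inverse label from all these \<open>u\<close>
    simultaneously.\<close>
  have val: "f (g \<otimes> p \<otimes> t) = g \<otimes> (u \<otimes> (inv t \<otimes> inv p) \<otimes> u)" if u: "u \<in> B" for u
  proof -
    have uG: "u \<in> carrier G" using BG u by simp
    have e: "(g \<otimes> u) \<otimes> (inv u \<otimes> p \<otimes> t) = g \<otimes> p \<otimes> t" using g uG G by (simp add: group_simps)
    have "f ((g \<otimes> u) \<otimes> (inv u \<otimes> p \<otimes> t)) \<in>
        {f (g \<otimes> u) \<otimes> (inv u \<otimes> p \<otimes> t), f (g \<otimes> u) \<otimes> inv (inv u \<otimes> p \<otimes> t)}"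
      using g uG u p t by (intro col) simp_all
    then have "f (g \<otimes> p \<otimes> t) \<in> {g \<otimes> p \<otimes> t, (g \<otimes> u) \<otimes> inv (inv u \<otimes> p \<otimes> t)}"
      unfolding e fix_B[OF u] .
    then have "f (g \<otimes> p \<otimes> t) = (g \<otimes> u) \<otimes> inv (inv u \<otimes> p \<otimes> t)" using neq by simp
    then show ?thesis using g uG G by (simp add: group_simps)
  qed
  define c where "c = inv t \<otimes> inv p"
  have cG: "c \<in> carrier G" unfolding c_def using G by simp
  have one: "f (g \<otimes> p \<otimes> t) = g \<otimes> c"
    using val[OF S1[OF S(2)]] g cG unfolding c_def[symmetric] by simp
  have inverts: "u \<otimes> c \<otimes> u = c" if u: "u \<in> B" for u
    using val[OF u] one BG[OF u] g cG unfolding c_def[symmetric] by simp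
  have comm: "a \<otimes> b = b \<otimes> a" if ab: "a \<in> S" "b \<in> S" for a b
  proof -
    have abG: "a \<in> carrier G" "b \<in> carrier G" using ab SG by auto
    have 1: "inv a \<otimes> c = c \<otimes> a"
    proof -
      have "inv a \<otimes> (a \<otimes> c \<otimes> a) = c \<otimes> a" using abG cG by (simp add: group_simps)
      then show ?thesis using inverts[OF S1[OF ab(1)]] by simp
    qed
    have 2: "inv b \<otimes> c = c \<otimes> b"
    proof -
      have "inv b \<otimes> (b \<otimes> c \<otimes> b) = c \<otimes> b" using abG cG by (simp add: group_simps)
      then show ?thesis using inverts[OF S1[OF ab(2)]] by simp
    qed
    have 3: "inv (a \<otimes> b) \<otimes> c = c \<otimes> (a \<otimes> b)"
    proof -
      have "inv (a \<otimes> b) \<otimes> ((a \<otimes> b) \<otimes> c \<otimes> (a \<otimes> b)) = c \<otimes> (a \<otimes> b)"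
        using abG cG by (simp add: group_simps)
      then show ?thesis using inverts[OF SB[OF ab]] by simp
    qed
    have "inv (a \<otimes> b) \<otimes> c = inv b \<otimes> (inv a \<otimes> c)" using abG cG by (simp add: group_simps)
    also have "\<dots> = inv b \<otimes> c \<otimes> a" using 1 abG cG by (simp add: m_assoc)
    also have "\<dots> = c \<otimes> (b \<otimes> a)" using 2 abG cG by (simp add: m_assoc)
    finally have "c \<otimes> (a \<otimes> b) = c \<otimes> (b \<otimes> a)" using 3 by simp
    then show ?thesis using abG cG by simp
  qed
  obtain a b where ab: "a \<in> S" "b \<in> S" "p = a \<otimes> b" using p unfolding B by auto
  have abG: "a \<in> carrier G" "b \<in> carrier G" using ab SG by auto
  have "p \<otimes> t = a \<otimes> (b \<otimes> t)" using ab abG G by (simp add: m_assoc)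
  also have "\<dots> = (a \<otimes> t) \<otimes> b" using comm[OF ab(2) t] abG G by (simp add: m_assoc)
  also have "\<dots> = t \<otimes> p" using comm[OF ab(1) t] ab(3) abG G by (simp add: m_assoc)
  finally have pt: "p \<otimes> t = t \<otimes> p" .
  have "t \<otimes> c \<otimes> t = inv p \<otimes> t" unfolding c_def using G by (simp add: group_simps)
  then have "inv p \<otimes> t = inv t \<otimes> inv p" using inverts[OF S1[OF t]] c_def by simp
  also have "\<dots> = inv (t \<otimes> p)" using pt G by (metis inv_mult_group)
  also have "\<dots> = inv p \<otimes> inv t" using G by (simp add: inv_mult_group)
  finally have tt: "inv t = t" using G by simp
  have "c = p \<otimes> c \<otimes> p" using inverts[OF p] by simp
  also have "\<dots> = p \<otimes> inv t" unfolding c_def using G by (simp add: group_simps)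
  finally have "c = p \<otimes> t" using tt by simp
  then show False using neq one g G by (simp add: m_assoc)
qed

text \<open>If the ball around \<open>h\<close> is fixed, so is the one around
  \<open>h \<otimes> s\<close>: its point \<open>h \<otimes> s \<otimes> (a \<otimes> b)\<close> is
  one letter \<open>b\<close> away from \<open>h \<otimes> (s \<otimes> a)\<close>, which lies in
  the first ball.\<close>

lemma fixed_ball_imp_fixed:
  assumes S: "S \<subseteq> carrier G" "\<one> \<in> S" "\<And>s. s \<in> S \<Longrightarrow> inv s \<in> S" "generate G S = carrier G"
    and B: "B = (\<lambda>(a, b). a \<otimes> b) ` (S \<times> S)"
    and col: "\<And>g u p t. g \<in> carrier G \<Longrightarrow> u \<in> B \<Longrightarrow> p \<in> B \<Longrightarrow> t \<in> S \<Longrightarrow>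
        f (g \<otimes> (inv u \<otimes> p \<otimes> t)) \<in> {f g \<otimes> (inv u \<otimes> p \<otimes> t), f g \<otimes> inv (inv u \<otimes> p \<otimes> t)}"
    and fix_B: "\<And>u. u \<in> B \<Longrightarrow> f u = u"
    and g: "g \<in> carrier G"
  shows "f g = g"
proof -
  have SB: "a \<otimes> b \<in> B" if "a \<in> S" "b \<in> S" for a b
    unfolding B using that by (intro image_eqI[of _ _ "(a, b)"]) auto
  have SG: "a \<in> carrier G" if "a \<in> S" for a using that S(1) by blast
  have BG: "u \<in> carrier G" if "u \<in> B" for u using that SG unfolding B by auto
  have step: "\<forall>u\<in>B. f (h \<otimes> s \<otimes> u) = h \<otimes> s \<otimes> u"
    if h: "h \<in> carrier G" "s \<in> S" "\<forall>u\<in>B. f (h \<otimes> u) = h \<otimes> u" for h s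
  proof
    fix u assume "u \<in> B"
    then obtain a b where ab: "a \<in> S" "b \<in> S" "u = a \<otimes> b" unfolding B by auto
    have "f (h \<otimes> (s \<otimes> a) \<otimes> b) = h \<otimes> (s \<otimes> a) \<otimes> b"
    proof (rule fixed_ball_propagates[OF S(1-3) B col h(1)])
      show "s \<otimes> a \<in> B" using SB h(2) ab(1) by simp
    qed (use h(3) ab(2) in simp_all)
    then show "f (h \<otimes> s \<otimes> u) = h \<otimes> s \<otimes> u"
      using ab(3) SG[OF ab(1)] SG[OF ab(2)] SG[OF h(2)] h(1) by (simp add: m_assoc)
  qed
  have "g \<in> generate G S" using g S(4) by simp
  with S(1) have "\<forall>u\<in>B. f (g \<otimes> u) = g \<otimes> u"
  proof (induction rule: generate_right_induct)
    case one
    show ?case using fix_B BG by simp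
  next
    case (mult g s)
    then show ?case by (intro step)
  next
    case (inv g s)
    then show ?case using S(3)[OF inv(2)] by (intro step)
  qed
  moreover have "\<one> \<in> B" using SB[OF S(2) S(2)] by simp
  ultimately show ?thesis using g by (metis r_one)
qed

text \<open>Composing \<open>f\<close> with the inverse of \<open>h\<close> gives an automorphism
  that fixes \<open>B\<close> pointwise.\<close>

lemma graph_auto_eqI:
  assumes T: "sparse_extension D T" "separated D T"
    and S: "S \<subseteq> carrier G" "\<one> \<in> S" "\<And>s. s \<in> S \<Longrightarrow> inv s \<in> S" "generate G S = carrier G"
    and B: "B = (\<lambda>(a, b). a \<otimes> b) ` (S \<times> S)"
    and D: "\<And>u p t. u \<in> B \<Longrightarrow> p \<in> B \<Longrightarrow> t \<in> S \<Longrightarrow> inv u \<otimes> p \<otimes> t \<in> insert \<one> D"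
    and f: "f \<in> graph_auto (cayley_graph G T)" "h \<in> graph_auto (cayley_graph G T)"
    and eq: "\<And>u. u \<in> B \<Longrightarrow> f u = h u"
  shows "f = h"
proof -
  define k where "k = inv\<^bsub>BijGroup (carrier G)\<^esub> h \<otimes>\<^bsub>BijGroup (carrier G)\<^esub> f"
  have V: "vertices (cayley_graph G T) = carrier G" by (simp add: cayley_graph_def)
  have bij: "f \<in> Bij (carrier G)" "h \<in> Bij (carrier G)" using f V by (auto simp: graph_auto_def)
  have fG: "f x \<in> carrier G" "h x \<in> carrier G" if "x \<in> carrier G" for x
    using bij[THEN Bij_imp_funcset] that by auto
  have h: "inj_on h (carrier G)" "h ` carrier G = carrier G"
    using bij(2) by (auto simp: Bij_def bij_betw_def)
  have kG: "k \<in> graph_auto (cayley_graph G T)"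
    using subgroup_graph_auto[of "cayley_graph G T"] f unfolding k_def V
    by (intro subgroup.m_closed subgroup.m_inv_closed)
  have comp: "p \<otimes>\<^bsub>BijGroup (carrier G)\<^esub> q = compose (carrier G) p q"
    if "p \<in> Bij (carrier G)" "q \<in> Bij (carrier G)" for p q
    using that by (simp add: BijGroup_def)
  have k: "k x = inv_into (carrier G) h (f x)" if "x \<in> carrier G" for x
    unfolding k_def inv_BijGroup[OF bij(2)] comp[OF restrict_inv_into_Bij[OF bij(2)] bij(1)]
    using that fG(1) by (simp add: compose_eq)
  have BG: "u \<in> carrier G" if "u \<in> B" for u using that S(1) unfolding B by auto
  have "f x = h x" if x: "x \<in> carrier G" for x
  proof -
    have "k x = x"
    proof (rule fixed_ball_imp_fixed[OF S B _ _ x])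
      show "k u = u" if "u \<in> B" for u
        using k[OF BG[OF that]] eq[OF that] h(1) BG[OF that] by (simp add: inv_into_f_f)
      show "k (g \<otimes> (inv u \<otimes> p \<otimes> t)) \<in> {k g \<otimes> (inv u \<otimes> p \<otimes> t), k g \<otimes> inv (inv u \<otimes> p \<otimes> t)}"
        if g: "g \<in> carrier G" and "u \<in> B" "p \<in> B" "t \<in> S" for g u p t
      proof (cases "inv u \<otimes> p \<otimes> t = \<one>")
        \<comment> \<open>\<open>\<one>\<close> is not a connection label, so separation says
          nothing about it; here both alternatives equal \<open>k g\<close>.\<close>
        case True
        have "k g \<in> carrier G" using kG g V Bij_imp_funcset by (fastforce simp: graph_auto_def)
        then show ?thesis using True g by simp
      next
        case False
        then have "inv u \<otimes> p \<otimes> t \<in> D" using D[OF that(2-4)] by simp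
        then show ?thesis using graph_auto_separated[OF T kG g] by simp
      qed
    qed
    then have "h (inv_into (carrier G) h (f x)) = h x" using k[OF x] by simp
    then show ?thesis using fG(1)[OF x] h(2) by (simp add: f_inv_into_f)
  qed
  moreover have "f \<in> extensional (carrier G)" "h \<in> extensional (carrier G)"
    using bij by (auto simp: Bij_def)
  ultimately show ?thesis by (intro extensionalityI) auto
qed

end

theorem corollary1p3:
  fixes G :: "('a, 'b) monoid_scheme" (structure)
  assumes "group G" and "finitely_generated G"
  shows "\<exists>S. finite S \<and> S \<subseteq> carrier G - {\<one>} \<and> symmetric_generating_set G S
           \<and> countable (carrier (GraphAutoGroup (cayley_graph G S)))"
proof -
  interpret group G by fact
  have auto_carrier: "carrier (GraphAutoGroup \<Gamma>) = graph_auto \<Gamma>" for \<Gamma> :: "'a simple_graph"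
    by (simp add: GraphAutoGroup_def)
  have auto_PiE: "graph_auto (cayley_graph G T) \<subseteq> carrier G \<rightarrow>\<^sub>E carrier G" for T
    by (auto simp: graph_auto_def cayley_graph_def PiE_def Bij_def bij_betw_def)
  obtain A where A: "finite A" "A \<subseteq> carrier G" "generate G A = carrier G"
    using assms(2) unfolding finitely_generated_def by blast
  have gen: "generate G T = carrier G" if "A \<subseteq> insert \<one> T" "T \<subseteq> carrier G" for T
  proof -
    have "A \<subseteq> generate G T" using that(1) by (auto intro: generate.intros)
    then have "generate G A \<subseteq> generate G T"
      by (rule generate_subgroup_incl[OF _ generate_is_subgroup[OF that(2)]])
    then have "carrier G \<subseteq> generate G T" using A(3) by simp
    then show ?thesis using generate_in_carrier[OF that(2)] by blast
  qed
  show ?thesis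
  proof (cases "finite (carrier G)")
    case True
    \<comment> \<open>A finite group has finitely many maps to itself, so the set of all nontrivial
      elements is good enough.\<close>
    let ?S = "carrier G - {\<one>}"
    have "symmetric_generating_set G ?S"
      unfolding symmetric_generating_set_def
      using m_inv_image_eq[of ?S] gen[of ?S] A(2) inv_eq_1_iff by auto
    moreover have "countable (graph_auto (cayley_graph G ?S))"
      using auto_PiE True by (meson countable_finite finite_PiE finite_subset)
    ultimately show ?thesis using True auto_carrier by (intro exI[of _ ?S]) simp
  next
    case False
    obtain V where V: "admissible V" using ex_generic[OF False A] unfolding admissible_def by blast
    \<comment> \<open>With \<open>\<one>\<close> in \<open>S\<close>, the choice
      \<open>u = p = \<one>\<close> shows that the labels in \<open>E\<close> include the
      generators.\<close>
    define S where "S = {\<one>} \<union> A \<union> m_inv G ` A"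
    define B where "B = (\<lambda>(a, b). a \<otimes> b) ` (S \<times> S)"
    define E where "E = (\<lambda>(u, p, t). inv u \<otimes> p \<otimes> t) ` (B \<times> B \<times> S)"
    define D where "D = E \<union> m_inv G ` E - {\<one>}"
    have S: "finite S" "S \<subseteq> carrier G" "\<one> \<in> S" "\<And>s. s \<in> S \<Longrightarrow> inv s \<in> S"
      unfolding S_def using A(1,2) by auto
    have genS: "generate G S = carrier G" using gen[OF _ S(2)] unfolding S_def by blast
    have B: "finite B" "B \<subseteq> carrier G" unfolding B_def using S(1,2) by auto
    have E: "finite E" "E \<subseteq> carrier G" unfolding E_def using B S(1,2) by auto
    have D: "finite D" "D \<subseteq> carrier G" "\<one> \<notin> D" "\<And>d. d \<in> D \<Longrightarrow> inv d \<in> D"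
      unfolding D_def using E inv_eq_1_iff by auto
    have ED: "inv u \<otimes> p \<otimes> t \<in> insert \<one> D" if "u \<in> B" "p \<in> B" "t \<in> S" for u p t
    proof -
      have "inv u \<otimes> p \<otimes> t \<in> E" unfolding E_def using that by force
      then show ?thesis unfolding D_def by simp
    qed
    obtain T where T: "sparse_extension D T" "separated D T" using ex_separated[OF V D] by blast
    have T': "finite T" "D \<subseteq> T" "T \<subseteq> carrier G" "\<one> \<notin> T" "\<And>t. t \<in> T \<Longrightarrow> inv t \<in> T"
      using T(1) unfolding sparse_extension_def by auto
    have "A \<subseteq> insert \<one> D"
    proof
      fix a assume a: "a \<in> A"
      have "\<one> \<otimes> \<one> \<in> B" unfolding B_def using S(3) by (intro image_eqI[of _ _ "(\<one>, \<one>)"]) auto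
      then have "\<one> \<in> B" by simp
      moreover have "a \<in> S" unfolding S_def using a by simp
      moreover have "a \<in> carrier G" using a A(2) by blast
      ultimately show "a \<in> insert \<one> D" using ED[of \<one> \<one> a] by simp
    qed
    then have "generate G T = carrier G" using gen[of T] T'(2,3) by blast
    then have sym: "symmetric_generating_set G T"
      unfolding symmetric_generating_set_def using T'(3) m_inv_image_eq[OF T'(3,5)] by simp
    \<comment> \<open>Listing \<open>B\<close> turns the values of an automorphism on it into a word
      over the group, and there are only countably many words.\<close>
    obtain l where l: "set l = B" using finite_list[OF B(1)] by blast
    have "inj_on (\<lambda>f. map f l) (graph_auto (cayley_graph G T))"
    proof (rule inj_onI)
      fix f h assume fh: "f \<in> graph_auto (cayley_graph G T)" "h \<in> graph_auto (cayley_graph G T)"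
        and "map f l = map h l"
      then have "f u = h u" if "u \<in> B" for u using that l by simp
      then show "f = h" using ED by (intro graph_auto_eqI[OF T S(2-4) genS B_def _ fh])
    qed
    moreover have "(\<lambda>f. map f l) ` graph_auto (cayley_graph G T) \<subseteq> lists (carrier G)"
      using auto_PiE[of T] B(2) l by (fastforce simp: PiE_def Pi_iff)
    moreover have "countable (lists (carrier G))"
      using countable_carrier[OF countable_finite[OF S(1)] S(2,4) genS] by simp
    ultimately have "countable (graph_auto (cayley_graph G T))"
      by (meson countable_image_inj_on countable_subset)
    then show ?thesis using T' sym auto_carrier by (intro exI[of _ T]) auto
  qed
qed

end
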